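(* Let $\mathbf{F}(s)=\sum_{n\ge 1} f(n)n^{-s}$ be an admissible Dirichlet series with abscissa of convergence $\alpha$, with $\mathbf{F}=e^{\mathbf{H}}$, $\mathbf{a}=\mathbf{H}'$, $\mathbf{b}=\mathbf{H}''$, and let $\beta>\alpha$ be such that $\mathbf{b}(\sigma)>0$ for all $\sigma\in(\alpha,\beta)$. For $x>0$ and $\sigma\in(\alpha,\beta)$ write $$\widehat{F}(x) \ =\ \frac{x^{\sigma+1}\,\mathbf{F}(\sigma)}{\sigma(\sigma+1)\sqrt{2\pi\, \mathbf{b}(\sigma)}}\left(\exp\left(\frac{-\big(\mathbf{a}(\sigma)+\log x\big)^2}{2\mathbf{b}(\sigma)}\right) + R(x,\sigma)\right),$$ which defines $R(x,\sigma)$. Then $R(x,\sigma)\to 0$ as $\sigma\to\alpha^+$, uniformly for $x>0$.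
   Context: Write $s=\sigma+it$. Suppose $\mathbf{F}(s)$ satisfies: (A1) $\mathbf{F}(s)=\sum_{n\ge1}f(n)n^{-s}$ is a Dirichlet series with nonnegative real coefficients and $f(1)>0$; (A2) its abscissa of (absolute) convergence is $\alpha\in[0,\infty)$; (A3) $\mathbf{F}(s)$ has no zeros in the half-plane $\sigma>\alpha$. Then $\mathbf{F}(s)=e^{\mathbf{H}(s)}$ for $\sigma>\alpha$, where $\mathbf{H}$ is the holomorphic logarithm of $\mathbf{F}$ that is real on $(\alpha,\infty)$. Put $\mathbf{a}=\mathbf{H}'$, $\mathbf{b}=\mathbf{H}''$ (complex derivatives), and define the remainder $\mathsf{R}$ by $\mathbf{H}(\sigma+it)=\mathbf{H}(\sigma)+i\mathbf{a}(\sigma)t-\tfrac{\mathbf{b}(\sigma)}{2}t^2+\mathsf{R}(\sigma+it)$ for $\sigma>\alpha$, $t\in\mathbb{R}$. $\mathbf{F}$ is called admissible if it satisfies (A1)-(A3) and there are $\beta_0>\alpha$ and a function $\delta:(\alpha,\beta_0)\to(0,1)$ such that, as $\sigma\to\alpha^+$: (A4) $\delta(\sigma)\to0$; (A5) $\sigma^2\mathbf{b}(\sigma)\to\infty$; (A6) $\mathbf{b}(\sigma)\exp\big(-\mathbf{b}(\sigma)\delta(\sigma)^2\big)\to0$; (A7) $\mathsf{R}(\sigma+it)\to0$ uniformly for $|t|\le\delta(\sigma)$; (A8) $\displaystyle\frac{\sigma\sqrt{\mathbf{b}(\sigma)}}{\mathbf{F}(\sigma)}\int_{|t|\ge\delta(\sigma)}|\mathbf{F}(\sigma+it)|\,\frac{dt}{\sigma^2+t^2}\to0$.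 By (A5), $\mathbf{b}(\sigma)\to\infty$ as $\sigma\to\alpha^+$, so a $\beta>\alpha$ with $\mathbf{b}>0$ on $(\alpha,\beta)$ exists. Notation: $F(x)=\sum_{n\le x}f(n)$ and $\widehat{F}(x)=\int_1^xF(u)\,du$ for $x>0$ (so $\widehat F(x)=0$ for $x\le1$). *)

theory Defs
  imports "HOL-Complex_Analysis.Complex_Analysis"
begin

text \<open>
  A Dirichlet series is given by its coefficient function \<open>f :: nat \<Rightarrow> real\<close>, of which only the values
  at \<open>n \<ge> 1\<close> matter: the sums below are shifted by \<open>Suc\<close> so that \<open>f 0\<close> is never used.
\<close>

definition dirichlet_term :: "(nat \<Rightarrow> real) \<Rightarrow> complex \<Rightarrow> nat \<Rightarrow> complex" where
  "dirichlet_term f s n = of_real (f (Suc n)) * of_nat (Suc n) powr (- s)"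

definition dirichlet_series :: "(nat \<Rightarrow> real) \<Rightarrow> complex \<Rightarrow> complex" where
  "dirichlet_series f s = (\<Sum>n. dirichlet_term f s n)"

text \<open>
  For nonnegative coefficients (the only case used here) the abscissas of convergence and of absolute
  convergence coincide.
\<close>

definition abscissa :: "(nat \<Rightarrow> real) \<Rightarrow> ereal" where
  "abscissa f = (INF s \<in> {s. summable (\<lambda>n. norm (dirichlet_term f s n))}. ereal (Re s))"

definition conv_half_plane :: "(nat \<Rightarrow> real) \<Rightarrow> complex set" where
  "conv_half_plane f = {s. abscissa f < ereal (Re s)}"

definition is_dirichlet_log :: "(nat \<Rightarrow> real) \<Rightarrow> (complex \<Rightarrow> complex) \<Rightarrow> bool" where
  "is_dirichlet_log f H \<longleftrightarrow>
     H holomorphic_on conv_half_plane f \<and>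
     (\<forall>s \<in> conv_half_plane f. dirichlet_series f s = exp (H s)) \<and>
     (\<forall>s \<in> conv_half_plane f. s \<in> \<real> \<longrightarrow> H s \<in> \<real>)"

text \<open>
  The choice is immaterial: by \<open>dirichlet_log_exists\<close> and \<open>dirichlet_log_unique\<close> below, the logarithm
  exists for zero-free series with nonnegative coefficients, and it is unique on the half-plane of
  convergence, which is open, so that its derivatives there are determined as well.
\<close>

definition dirichlet_log :: "(nat \<Rightarrow> real) \<Rightarrow> complex \<Rightarrow> complex" where
  "dirichlet_log f = (SOME H. is_dirichlet_log f H)"

lemma norm_dirichlet_term:
  "norm (dirichlet_term f s n) = \<bar>f (Suc n)\<bar> * real (Suc n) powr (- Re s)"
  by (simp add: dirichlet_term_def norm_mult norm_powr_real_powr del: of_nat_Suc)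

lemma conv_half_plane_eq:
  assumes "abscissa f = ereal \<alpha>"
  shows "conv_half_plane f = {s. \<alpha> < Re s}"
  using assms by (simp add: conv_half_plane_def)

lemma summable_dirichlet_term:
  assumes "s \<in> conv_half_plane f"
  obtains s0 where "Re s0 < Re s" "summable (\<lambda>n. norm (dirichlet_term f s0 n))"
  using assms by (auto simp: conv_half_plane_def abscissa_def INF_less_iff)

lemma norm_dirichlet_term_mono:
  assumes "Re s0 \<le> Re s"
  shows "norm (dirichlet_term f s n) \<le> norm (dirichlet_term f s0 n)"
  unfolding norm_dirichlet_term
  using assms by (intro mult_left_mono powr_mono) auto

lemma dirichlet_series_sums:
  assumes "s \<in> conv_half_plane f"
  shows "dirichlet_term f s sums dirichlet_series f s"
proof -
  obtain s0 where s0: "Re s0 < Re s" "summable (\<lambda>n. norm (dirichlet_term f s0 n))"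
    using summable_dirichlet_term[OF assms] .
  have "summable (\<lambda>n. norm (dirichlet_term f s n))"
    by (rule summable_comparison_test'[OF s0(2), of 0])
       (use s0 in \<open>simp add: norm_dirichlet_term_mono\<close>)
  then have "summable (dirichlet_term f s)" by (rule summable_norm_cancel)
  then show ?thesis
    unfolding dirichlet_series_def by (rule summable_sums)
qed

lemma dirichlet_series_holomorphic:
  assumes "abscissa f = ereal \<alpha>"
  shows "dirichlet_series f holomorphic_on conv_half_plane f"
proof -
  let ?S = "conv_half_plane f"
  have op: "open ?S"
    unfolding conv_half_plane_eq[OF assms] by (rule open_halfspace_Re_gt)
  obtain g where g: "\<forall>x\<in>?S. ((\<lambda>n. dirichlet_term f x n) sums g x) \<and> g field_differentiable (at x)"
  proof (rule series_differentiable_comparison_complex[OF op, of "\<lambda>n x. dirichlet_term f x n"])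
    fix n x
    show "(\<lambda>x. dirichlet_term f x n) field_differentiable at x"
    proof -
      have "(\<lambda>x. of_real (f (Suc n)) * exp (- x * Ln (of_nat (Suc n)))) field_differentiable at x"
        by (rule holomorphic_on_imp_differentiable_at[of _ UNIV]) (auto intro!: holomorphic_intros)
      moreover have "complex_of_nat (Suc n) \<noteq> 0" by (simp del: of_nat_Suc)
      ultimately show ?thesis
        unfolding dirichlet_term_def powr_def by (simp only: if_False)
    qed
  next
    fix x assume "x \<in> ?S"
    then obtain s0 where s0: "Re s0 < Re x" "summable (\<lambda>n. norm (dirichlet_term f s0 n))"
      using summable_dirichlet_term by blast
    have "norm (dirichlet_term f y n) \<le> norm (dirichlet_term f s0 n)"
      if "y \<in> ball x (Re x - Re s0)" for y n
    proof (rule norm_dirichlet_term_mono)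
      have "\<bar>Re x - Re y\<bar> < Re x - Re s0"
        using that abs_Re_le_cmod[of "x - y"] by (simp add: dist_norm)
      then show "Re s0 \<le> Re y" by linarith
    qed
    then show "\<exists>d h. 0 < d \<and> summable h \<and> range h \<subseteq> \<real>\<^sub>\<ge>\<^sub>0 \<and>
        (\<forall>\<^sub>F n in sequentially. \<forall>y\<in>ball x d \<inter> ?S. cmod (dirichlet_term f y n) \<le> cmod (h n))"
      using s0
      by (intro exI[of _ "Re x - Re s0"] exI[of _ "\<lambda>n. of_real (norm (dirichlet_term f s0 n))"])
         (auto intro!: summable_of_real)
  qed blast
  have "g x = dirichlet_series f x" if "x \<in> ?S" for x
    using g that dirichlet_series_sums sums_unique2 by blast
  moreover have "g holomorphic_on ?S"
    using g field_differentiable_at_within unfolding holomorphic_on_def by blast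
  ultimately show ?thesis
    by (simp cong: holomorphic_cong)
qed

lemma dirichlet_series_real_pos:
  assumes "\<forall>n\<ge>1. f n \<ge> 0" "f 1 > 0" "of_real \<sigma> \<in> conv_half_plane f"
  shows "\<exists>c>0. dirichlet_series f (of_real \<sigma>) = of_real c"
proof -
  let ?t = "\<lambda>n. f (Suc n) * real (Suc n) powr (- \<sigma>)"
  have eq: "dirichlet_term f (of_real \<sigma>) n = of_real (?t n)" for n
    using powr_of_real[of "real (Suc n)" "- \<sigma>"]
    by (simp add: dirichlet_term_def del: of_nat_Suc)
  have S: "(\<lambda>n. of_real (?t n) :: complex) sums dirichlet_series f (of_real \<sigma>)"
    using dirichlet_series_sums[OF assms(3)] by (simp only: eq[abs_def])
  then have R: "summable ?t"
    using sums_summable summable_complex_of_real by blast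
  have "suminf ?t > 0"
    by (rule suminf_pos2[OF R, of 0]) (use assms in auto)
  moreover have "dirichlet_series f (of_real \<sigma>) = of_real (suminf ?t)"
    using S sums_unique2 sums_of_real[OF summable_sums[OF R]] by blast
  ultimately show ?thesis by blast
qed

lemma dirichlet_log_exists:
  assumes coeffs: "\<forall>n\<ge>1. f n \<ge> 0" "f 1 > 0"
    and absc: "abscissa f = ereal \<alpha>"
    and nz: "\<forall>s. Re s > \<alpha> \<longrightarrow> dirichlet_series f s \<noteq> 0"
  shows "is_dirichlet_log f (dirichlet_log f)"
proof -
  let ?S = "conv_half_plane f"
  note S = conv_half_plane_eq[OF absc]
  have "convex ?S" unfolding S by (rule convex_halfspace_Re_gt)
  obtain g where g: "g holomorphic_on ?S" "\<And>s. s \<in> ?S \<Longrightarrow> dirichlet_series f s = exp (g s)"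
  proof (rule holomorphic_logarithm_exists[of ?S "dirichlet_series f" "of_real (\<alpha> + 1)"])
    show "open ?S" unfolding S by (rule open_halfspace_Re_gt)
  qed (use \<open>convex ?S\<close> dirichlet_series_holomorphic[OF absc] nz in \<open>auto simp: S\<close>)
  define h where "h = (\<lambda>\<sigma>. Im (g (of_real \<sigma>)))"
  have cis1: "cis (h \<sigma>) = 1" if "\<sigma> \<in> {\<alpha><..}" for \<sigma>
  proof -
    have "of_real \<sigma> \<in> ?S" using that by (simp add: S)
    then obtain c where "c > 0" "exp (g (of_real \<sigma>)) = of_real c"
      using dirichlet_series_real_pos[OF coeffs] g(2) by metis
    then have "of_real (exp (Re (g (of_real \<sigma>)))) * cis (h \<sigma>) = of_real c"
      by (simp add: exp_eq_polar h_def)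
    moreover from this have "exp (Re (g (of_real \<sigma>))) = c"
      using \<open>c > 0\<close> by (metis abs_exp_cancel abs_of_pos mult.right_neutral norm_cis norm_mult norm_of_real)
    ultimately show ?thesis using \<open>c > 0\<close> by simp
  qed
  have "h constant_on {\<alpha><..}"
  proof (rule continuous_discrete_range_constant)
    show "connected {\<alpha><..}" by simp
    show "continuous_on {\<alpha><..} h"
    proof -
      have "continuous_on {\<alpha><..} (g \<circ> of_real)"
        by (rule continuous_on_compose[OF continuous_on_of_real_id continuous_on_subset[OF
              holomorphic_on_imp_continuous_on[OF g(1)]]]) (auto simp: S)
      then show ?thesis
        unfolding h_def o_def by (rule continuous_on_Im)
    qed
    fix x assume x: "x \<in> {\<alpha><..}"
    have "1 \<le> norm (h y - h x)" if "y \<in> {\<alpha><..}" "h y \<noteq> h x" for y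
    proof -
      have "cis (h y - h x) = 1"
        using cis1[OF x] cis1[OF that(1)] by (simp flip: cis_divide)
      then have "cos (h y - h x) = 1" by (simp add: complex_eq_iff)
      then obtain k :: int where k: "h y - h x = of_int k * 2 * pi"
        using cos_one_2pi_int by blast
      then have "k \<noteq> 0" using that by auto
      then have "1 \<le> \<bar>real_of_int k\<bar>" by linarith
      then have "1 * 1 \<le> \<bar>real_of_int k\<bar> * (2 * pi)"
        using pi_gt3 by (intro mult_mono) auto
      then show ?thesis using k by (simp add: abs_mult)
    qed
    then show "\<exists>e>0. \<forall>y. y \<in> {\<alpha><..} \<and> h y \<noteq> h x \<longrightarrow> e \<le> norm (h y - h x)"
      by (intro exI[of _ 1]) auto
  qed
  then obtain c where c: "\<And>\<sigma>. \<sigma> > \<alpha> \<Longrightarrow> h \<sigma> = c"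
    by (auto simp: constant_on_def)
  have "cis c = 1" using cis1[of "\<alpha> + 1"] c[of "\<alpha> + 1"] by simp
  then have ec: "exp (\<i> * of_real c) = 1" by (simp add: cis_conv_exp)
  have "is_dirichlet_log f (\<lambda>s. g s - \<i> * of_real c)"
    unfolding is_dirichlet_log_def
  proof (intro conjI ballI impI)
    show "(\<lambda>s. g s - \<i> * of_real c) holomorphic_on ?S"
      by (intro holomorphic_intros g)
    show "dirichlet_series f s = exp (g s - \<i> * of_real c)" if "s \<in> ?S" for s
      using g(2)[OF that] ec by (simp add: exp_diff)
    show "g s - \<i> * of_real c \<in> \<real>" if "s \<in> ?S" "s \<in> \<real>" for s
    proof -
      obtain \<sigma> where "s = of_real \<sigma>" using \<open>s \<in> \<real>\<close> by (rule Reals_cases)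
      then show ?thesis using that c[of \<sigma>] by (simp add: S h_def complex_is_Real_iff)
    qed
  qed
  then show ?thesis
    unfolding dirichlet_log_def by (rule someI[of "is_dirichlet_log f"])
qed

lemma dirichlet_log_unique:
  assumes absc: "abscissa f = ereal \<alpha>"
    and H: "is_dirichlet_log f H" "is_dirichlet_log f H'" and s: "s \<in> conv_half_plane f"
  shows "H s = H' s"
proof -
  let ?S = "conv_half_plane f"
  let ?U = "complex_of_real ` {\<alpha><..}"
  note S = conv_half_plane_eq[OF absc]
  have agree: "H z - H' z = 0" if "z \<in> ?U" for z
  proof -
    have z: "z \<in> ?S" "z \<in> \<real>" using that by (auto simp: S)
    then obtain x y where xy: "H z = of_real x" "H' z = of_real y"
      using H unfolding is_dirichlet_log_def by (metis Reals_cases)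
    have "exp (H z) = exp (H' z)"
      using H z unfolding is_dirichlet_log_def by metis
    then have "complex_of_real (exp x) = of_real (exp y)"
      by (simp only: xy exp_of_real)
    then have "x = y" by (simp only: of_real_eq_iff exp_inj_iff)
    then show ?thesis using xy by simp
  qed
  have "(\<lambda>s. H s - H' s) holomorphic_on ?S"
    using H by (auto simp: is_dirichlet_log_def intro!: holomorphic_intros)
  moreover have "open ?S" "connected ?S"
    unfolding S by (simp_all add: open_halfspace_Re_gt convex_connected convex_halfspace_Re_gt)
  moreover have "?U \<subseteq> ?S" "of_real (\<alpha> + 1) \<in> ?S" by (auto simp: S)
  moreover have "of_real (\<alpha> + 1) islimpt ?U"
    unfolding islimpt_approachable
  proof (intro allI impI)
    fix e :: real assume "e > 0"
    then show "\<exists>z\<in>?U. z \<noteq> of_real (\<alpha> + 1) \<and> dist z (of_real (\<alpha> + 1)) < e"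
      by (intro bexI[of _ "of_real (\<alpha> + 1 + e / 2)"]) (auto simp: dist_real_def simp del: of_real_add)
  qed
  ultimately have "H s - H' s = 0"
    using agree s by (intro analytic_continuation[of "\<lambda>s. H s - H' s" ?S ?U "of_real (\<alpha> + 1)" s]) auto
  then show ?thesis by simp
qed

text \<open>
  The restrictions of \<open>F\<close>, \<open>H'\<close> and \<open>H''\<close> to the real axis, as real functions. As the coefficients are
  real and \<open>H\<close> is real on the axis, taking \<open>Re\<close> only changes the type.
\<close>

definition F_real :: "(nat \<Rightarrow> real) \<Rightarrow> real \<Rightarrow> real" where
  "F_real f \<sigma> = Re (dirichlet_series f (of_real \<sigma>))"

definition a_fun :: "(nat \<Rightarrow> real) \<Rightarrow> real \<Rightarrow> real" where
  "a_fun f \<sigma> = Re (deriv (dirichlet_log f) (of_real \<sigma>))"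

definition b_fun :: "(nat \<Rightarrow> real) \<Rightarrow> real \<Rightarrow> real" where
  "b_fun f \<sigma> = Re (deriv (deriv (dirichlet_log f)) (of_real \<sigma>))"

definition log_remainder :: "(nat \<Rightarrow> real) \<Rightarrow> real \<Rightarrow> real \<Rightarrow> complex" where
  "log_remainder f \<sigma> t =
     dirichlet_log f (Complex \<sigma> t) -
     (dirichlet_log f (of_real \<sigma>) + \<i> * of_real (a_fun f \<sigma>) * of_real t
        - of_real (b_fun f \<sigma>) / 2 * (of_real t)\<^sup>2)"

text \<open>
  The integral below never takes the default value of a non-integrable function: for \<open>\<sigma> > \<alpha> \<ge> 0\<close> its
  integrand is continuous and dominated by \<open>F \<sigma> / (\<sigma>\<^sup>2 + t\<^sup>2)\<close>.
\<close>

definition admissible :: "(nat \<Rightarrow> real) \<Rightarrow> real \<Rightarrow> bool" where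
  "admissible f \<alpha> \<longleftrightarrow>
     (\<forall>n\<ge>1. f n \<ge> 0) \<and> f 1 > 0 \<and>
     abscissa f = ereal \<alpha> \<and> \<alpha> \<ge> 0 \<and>
     (\<forall>s. Re s > \<alpha> \<longrightarrow> dirichlet_series f s \<noteq> 0) \<and>
     (\<exists>\<beta>\<^sub>0 \<delta>. \<beta>\<^sub>0 > \<alpha> \<and>
        (\<forall>\<sigma>\<in>{\<alpha><..<\<beta>\<^sub>0}. \<delta> \<sigma> \<in> {0<..<1}) \<and>
        (\<delta> \<longlongrightarrow> 0) (at_right \<alpha>) \<and>
        filterlim (\<lambda>\<sigma>. \<sigma>\<^sup>2 * b_fun f \<sigma>) at_top (at_right \<alpha>) \<and>
        ((\<lambda>\<sigma>. b_fun f \<sigma> * exp (- b_fun f \<sigma> * (\<delta> \<sigma>)\<^sup>2)) \<longlongrightarrow> 0) (at_right \<alpha>) \<and>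
        (\<forall>\<epsilon>>0. \<forall>\<^sub>F \<sigma> in at_right \<alpha>. \<forall>t. \<bar>t\<bar> \<le> \<delta> \<sigma> \<longrightarrow> norm (log_remainder f \<sigma> t) < \<epsilon>) \<and>
        ((\<lambda>\<sigma>. \<sigma> * sqrt (b_fun f \<sigma>) / F_real f \<sigma> *
              (LBINT t:{t. \<bar>t\<bar> \<ge> \<delta> \<sigma>}.
                 norm (dirichlet_series f (Complex \<sigma> t)) / (\<sigma>\<^sup>2 + t\<^sup>2))) \<longlongrightarrow> 0) (at_right \<alpha>))"

definition coeff_sum :: "(nat \<Rightarrow> real) \<Rightarrow> real \<Rightarrow> real" where
  "coeff_sum f x = (\<Sum>n | 1 \<le> n \<and> real n \<le> x. f n)"

text \<open>
  Oriented integral; it vanishes for \<open>x \<le> 1\<close> because \<open>coeff_sum f u = 0\<close> for \<open>u < 1\<close>.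
\<close>

definition coeff_sum_integral :: "(nat \<Rightarrow> real) \<Rightarrow> real \<Rightarrow> real" where
  "coeff_sum_integral f x = (LBINT u=1..ereal x. coeff_sum f u)"

end

theory Submission
  imports Defs "HOL-Probability.Probability"
begin

text \<open>
  Perron's formula writes \<open>coeff_sum_integral f x\<close> as \<open>x powr (\<sigma> + 1) / (2 \<pi>)\<close> times the integral of
  \<open>F(s) x\<^sup>i\<^sup>t / (s (s + 1))\<close> over the line \<open>Re s = \<sigma>\<close>. After normalisation the integrand is, for small
  \<open>t\<close>, close to \<open>exp (i (a + ln x) t - b t\<^sup>2 / 2)\<close>, whose integral is the Gaussian main term, and the absolute
  value of the difference has a bound that does not involve \<open>x\<close>. The kernel of Perron's formula is
  obtained by Fourier inversion, as \<open>1 / (s (s + 1))\<close> is the Laplace transform of \<open>1 - exp (- v)\<close>.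
\<close>

section \<open>Gaussian integrals and Fourier inversion\<close>

text \<open>Written as a multiple of the normal density of variance \<open>1 / b\<close>, the
  Gaussian inherits the known mass and moments of that density.\<close>

lemma exp_gaussian_eq_normal_density:
  assumes "b > 0"
  shows "exp (- b * t\<^sup>2 / 2) = sqrt (2 * pi / b) * normal_density 0 (1 / sqrt b) t"
  using assms by (simp add: normal_density_def real_sqrt_divide real_sqrt_mult power_divide field_simps)

lemma has_bochner_integral_gaussian:
  assumes "b > 0"
  shows "has_bochner_integral lborel (\<lambda>t::real. exp (- b * t\<^sup>2 / 2)) (sqrt (2 * pi / b))"
  using assms by (simp only: exp_gaussian_eq_normal_density has_bochner_integral_iff) simp

text \<open>This moment pays for replacing the normalised Perron weight, which is within
  \<open>2 * \<bar>t\<bar> / \<sigma>\<close> of 1, by 1 under the Gaussian.\<close>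

lemma has_bochner_integral_gaussian_abs:
  assumes "b > 0"
  shows "has_bochner_integral lborel (\<lambda>t::real. \<bar>t\<bar> * exp (- b * t\<^sup>2 / 2)) (2 / b)"
proof -
  \<comment> \<open>The absolute odd moments have order \<open>2 * k + 1\<close>;
    \<open>k = 0\<close> gives the first one.\<close>
  have "has_bochner_integral lborel (\<lambda>t. normal_density 0 (1 / sqrt b) t * \<bar>t\<bar>)
    (1 / sqrt b * sqrt (2 / pi))"
    using normal_moment_abs_odd[of "1 / sqrt b" 0 0] assms by simp
  from has_bochner_integral_mult_right[OF this, of "sqrt (2 * pi / b)"]
  moreover have "sqrt (2 * pi / b) * (1 / sqrt b * sqrt (2 / pi)) = 2 / b"
    using assms by (simp add: real_sqrt_divide real_sqrt_mult divide_simps)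
  moreover have "(\<lambda>t. sqrt (2 * pi / b) * (normal_density 0 (1 / sqrt b) t * \<bar>t\<bar>)) =
      (\<lambda>t. \<bar>t\<bar> * exp (- b * t\<^sup>2 / 2))"
    by (simp only: exp_gaussian_eq_normal_density[OF assms] mult_ac)
  ultimately show ?thesis by (simp only:)
qed

text \<open>The substitution \<open>x = sqrt b * t\<close> reduces this to the characteristic
  function of the standard normal distribution at \<open>y / sqrt b\<close>.\<close>

lemma gaussian_fourier:
  fixes b y :: real
  assumes "b > 0"
  shows "(CLBINT t. iexp (y * t) * of_real (exp (- b * t\<^sup>2 / 2))) =
    of_real (sqrt (2 * pi / b) * exp (- y\<^sup>2 / (2 * b)))"
proof -
  let ?u = "y / sqrt b"
  have "of_real (exp (- y\<^sup>2 / (2 * b))) = char std_normal_distribution ?u"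
    using assms by (simp add: char_std_normal_distribution power_divide mult.commute)
  also have "\<dots> = (CLBINT x. std_normal_density x *\<^sub>R iexp (?u * x))"
    unfolding char_def by (rule integral_density) auto
  also have "\<dots> = sqrt b *\<^sub>R (CLBINT t. std_normal_density (0 + sqrt b * t) *\<^sub>R iexp (?u * (0 + sqrt b * t)))"
    using lborel_integral_real_affine[of "sqrt b" "\<lambda>x. std_normal_density x *\<^sub>R iexp (?u * x)" 0] assms
    by simp
  also have "(\<lambda>t. std_normal_density (0 + sqrt b * t) *\<^sub>R iexp (?u * (0 + sqrt b * t))) =
      (\<lambda>t. (1 / sqrt (2 * pi)) *\<^sub>R (iexp (y * t) * of_real (exp (- b * t\<^sup>2 / 2))))"
    using assms by (simp add: std_normal_density_def fun_eq_iff power_mult_distrib scaleR_conv_of_real)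
  also have "sqrt b *\<^sub>R (CLBINT t. (1 / sqrt (2 * pi)) *\<^sub>R (iexp (y * t) * of_real (exp (- b * t\<^sup>2 / 2)))) =
      (sqrt b / sqrt (2 * pi)) *\<^sub>R (CLBINT t. iexp (y * t) * of_real (exp (- b * t\<^sup>2 / 2)))"
    by (subst integral_scaleR_right) simp
  finally have "sqrt (2 * pi / b) *\<^sub>R of_real (exp (- y\<^sup>2 / (2 * b))) =
    (sqrt (2 * pi / b) * (sqrt b / sqrt (2 * pi))) *\<^sub>R
      (CLBINT t. iexp (y * t) * of_real (exp (- b * t\<^sup>2 / 2)))"
    by (simp only: scaleR_scaleR)
  moreover have "sqrt (2 * pi / b) * (sqrt b / sqrt (2 * pi)) = 1"
    using assms by (simp add: real_sqrt_divide)
  ultimately show ?thesis by (simp only: scaleR_conv_of_real of_real_mult of_real_1 mult_1)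
qed

text \<open>
  Damping the integrand by \<open>exp (- e\<^sup>2 t\<^sup>2 / 2)\<close> makes Fubini applicable and turns the inversion
  integral into an average of \<open>g (x + e z)\<close> over a standard normal \<open>z\<close>; then \<open>e\<close> tends to 0.
\<close>

theorem fourier_inversion:
  fixes g :: "real \<Rightarrow> complex"
  defines "h \<equiv> \<lambda>t. CLBINT v. g v * iexp (- (t * v))"
  assumes g: "integrable lborel g" and cont: "continuous_on UNIV g" and bdd: "\<And>v. norm (g v) \<le> B"
    and h: "integrable lborel h"
  shows "(CLBINT t. h t * iexp (t * x)) = 2 * of_real pi * g x"
proof -
  have [measurable]: "g \<in> borel_measurable borel"
    using cont by (rule borel_measurable_continuous_onI)
  have [measurable]: "h \<in> borel_measurable borel"
    using h by (auto dest: borel_measurable_integrable)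
  \<comment> \<open>A positive null sequence of damping parameters, in the form that dominated
    convergence for sequences requires.\<close>
  define e where "e = (\<lambda>n::nat. 1 / (real n + 1))"
  have e_pos: "e n > 0" for n by (simp add: e_def)
  have e_lim: "e \<longlonglongrightarrow> 0" unfolding e_def by real_asymp
  define G where "G = (\<lambda>(c::real) (t::real). complex_of_real (exp (- c\<^sup>2 * t\<^sup>2 / 2)))"
  have [measurable]: "G c \<in> borel_measurable borel" for c unfolding G_def by measurable
  have damped: "(CLBINT t. h t * iexp (t * x) * G c t) =
      of_real (sqrt (2 * pi)) * (CLBINT z. g (x + c * z) * G 1 z)" if c: "c > 0" for c
  proof -
    let ?k = "\<lambda>v t. g v * iexp (t * (x - v)) * G c t"
    have Gint: "integrable lborel (\<lambda>t. exp (- c\<^sup>2 * t\<^sup>2 / 2))"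
      using has_bochner_integral_gaussian[of "c\<^sup>2"] c by (auto simp: has_bochner_integral_iff)
    have kint: "integrable lborel (\<lambda>t. ?k v t)" for v
    proof (rule Bochner_Integration.integrable_bound)
      show "integrable lborel (\<lambda>t. norm (g v) * exp (- c\<^sup>2 * t\<^sup>2 / 2))"
        using Gint by simp
    qed (auto simp: norm_mult G_def)
    have "integrable (lborel \<Otimes>\<^sub>M lborel) (\<lambda>(v, t). ?k v t)"
    proof (rule lborel_pair.Fubini_integrable)
      have "(\<lambda>v. \<integral>t. norm (case (v, t) of (v, t) \<Rightarrow> ?k v t) \<partial>lborel) =
          (\<lambda>v. norm (g v) * (\<integral>t. exp (- c\<^sup>2 * t\<^sup>2 / 2) \<partial>lborel))"
        by (simp add: norm_mult G_def)
      then show "integrable lborel (\<lambda>v. \<integral>t. norm (case (v, t) of (v, t) \<Rightarrow> ?k v t) \<partial>lborel)"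
        using g by simp
    qed (use kint in auto)
    then have fubini: "(CLBINT t. CLBINT v. ?k v t) = (CLBINT v. CLBINT t. ?k v t)"
      by (rule lborel_pair.Fubini_integral)
    have "(CLBINT t. h t * iexp (t * x) * G c t) = (CLBINT t. CLBINT v. ?k v t)"
    proof (rule Bochner_Integration.integral_cong[OF refl])
      fix t
      have "h t * iexp (t * x) * G c t = h t * (iexp (t * x) * G c t)" by simp
      also have "\<dots> = (CLBINT v. g v * iexp (- (t * v)) * (iexp (t * x) * G c t))"
        unfolding h_def
        by (rule integral_mult_left_zero[symmetric])
      also have "\<dots> = (CLBINT v. ?k v t)"
        by (intro Bochner_Integration.integral_cong refl)
           (simp add: exp_add[symmetric] exp_diff exp_minus algebra_simps divide_inverse)
      finally show "h t * iexp (t * x) * G c t = (CLBINT v. ?k v t)" .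
    qed
    also have "\<dots> = (CLBINT v. CLBINT t. ?k v t)" by (rule fubini)
    also have "\<dots> = (CLBINT v. g v * of_real (sqrt (2 * pi) / c * exp (- (x - v)\<^sup>2 / (2 * c\<^sup>2))))"
    proof (rule Bochner_Integration.integral_cong[OF refl])
      fix v
      have "(CLBINT t. ?k v t) = g v * (CLBINT t. iexp ((x - v) * t) * of_real (exp (- c\<^sup>2 * t\<^sup>2 / 2)))"
        by (subst integral_mult_right_zero[symmetric]) (simp add: G_def mult_ac)
      also have "\<dots> = g v * of_real (sqrt (2 * pi) / c * exp (- (x - v)\<^sup>2 / (2 * c\<^sup>2)))"
        using c by (subst gaussian_fourier) (simp_all add: real_sqrt_divide real_sqrt_mult)
      finally show "(CLBINT t. ?k v t) = \<dots>" .
    qed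
    \<comment> \<open>After \<open>v = x + c * z\<close> the exponent is
      \<open>- z\<^sup>2 / 2\<close>: the weight becomes \<open>G 1\<close>, and \<open>c\<close>
      survives only in the argument of \<open>g\<close>.\<close>
    also have "\<dots> = c *\<^sub>R (CLBINT z. g (x + c * z) *
        of_real (sqrt (2 * pi) / c * exp (- (x - (x + c * z))\<^sup>2 / (2 * c\<^sup>2))))"
      using c by (subst lborel_integral_real_affine[of c _ x]) auto
    also have "(\<lambda>z. g (x + c * z) *
        of_real (sqrt (2 * pi) / c * exp (- (x - (x + c * z))\<^sup>2 / (2 * c\<^sup>2)))) =
        (\<lambda>z. of_real (sqrt (2 * pi) / c) * (g (x + c * z) * G 1 z))"
      using c by (simp add: fun_eq_iff G_def power_mult_distrib)
    also have "c *\<^sub>R (CLBINT z. of_real (sqrt (2 * pi) / c) * (g (x + c * z) * G 1 z)) =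
        of_real (sqrt (2 * pi)) * (CLBINT z. g (x + c * z) * G 1 z)"
      using c by (subst integral_mult_right_zero) (simp add: scaleR_conv_of_real)
    finally show ?thesis .
  qed
  \<comment> \<open>Left-hand side of \<open>damped\<close>: the damping factor tends to 1, and
    \<open>norm (h t)\<close> is a majorant.\<close>
  have "(\<lambda>n. CLBINT t. h t * iexp (t * x) * G (e n) t) \<longlonglongrightarrow> (CLBINT t. h t * iexp (t * x))"
  proof (rule integral_dominated_convergence[where w = "\<lambda>t. norm (h t)"])
    show "AE t in lborel. (\<lambda>n. h t * iexp (t * x) * G (e n) t) \<longlonglongrightarrow> h t * iexp (t * x)"
    proof (rule AE_I2)
      fix t
      have "(\<lambda>n. h t * iexp (t * x) * of_real (exp (- (e n)\<^sup>2 * t\<^sup>2 / 2))) \<longlonglongrightarrow>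
          h t * iexp (t * x) * of_real (exp (- 0\<^sup>2 * t\<^sup>2 / 2))"
        by (intro tendsto_intros e_lim) auto
      then show "(\<lambda>n. h t * iexp (t * x) * G (e n) t) \<longlonglongrightarrow> h t * iexp (t * x)"
        by (simp add: G_def)
    qed
  qed (use h in \<open>auto simp: norm_mult G_def intro!: mult_left_le\<close>)
  \<comment> \<open>Right-hand side of \<open>damped\<close>: continuity gives the pointwise limit,
    and boundedness of \<open>g\<close> supplies a Gaussian majorant.\<close>
  moreover have "(\<lambda>n. of_real (sqrt (2 * pi)) * (CLBINT z. g (x + e n * z) * G 1 z)) \<longlonglongrightarrow>
      of_real (sqrt (2 * pi)) * (CLBINT z. g x * G 1 z)"
  proof (intro tendsto_mult[OF tendsto_const]
      integral_dominated_convergence[where w = "\<lambda>z. B * exp (- 1 * z\<^sup>2 / 2)"] AE_I2)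
    show "integrable lborel (\<lambda>z. B * exp (- 1 * z\<^sup>2 / 2))"
      using has_bochner_integral_gaussian[of 1] by (auto simp: has_bochner_integral_iff)
    show "(\<lambda>n. g (x + e n * z) * G 1 z) \<longlonglongrightarrow> g x * G 1 z" for z
    proof (intro tendsto_mult[OF _ tendsto_const] isCont_tendsto_compose[of x g])
      show "isCont g x" using cont by (simp add: continuous_on_eq_continuous_at)
      have "(\<lambda>n. x + e n * z) \<longlonglongrightarrow> x + 0 * z" by (intro tendsto_intros e_lim)
      then show "(\<lambda>n. x + e n * z) \<longlonglongrightarrow> x" by simp
    qed
  qed (use bdd in \<open>auto simp: norm_mult G_def\<close>)
  ultimately have "(CLBINT t. h t * iexp (t * x)) = of_real (sqrt (2 * pi)) * (CLBINT z. g x * G 1 z)"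
    using damped[OF e_pos] by (simp add: LIMSEQ_unique)
  \<comment> \<open>Frequency 0 gives the mass \<open>sqrt (2 * pi)\<close>, which combines with the
    equal prefactor to \<open>2 * pi\<close>.\<close>
  also have "(CLBINT z. g x * G 1 z) = g x * of_real (sqrt (2 * pi))"
    using gaussian_fourier[of 1 0] unfolding G_def by (subst integral_mult_right_zero) simp
  also have "of_real (sqrt (2 * pi)) * (g x * of_real (sqrt (2 * pi))) =
      of_real (sqrt (2 * pi) * sqrt (2 * pi)) * g x"
    by (simp only: of_real_mult mult_ac)
  finally show ?thesis by simp
qed

section \<open>Perron's formula\<close>

text \<open>The antiderivative \<open>- exp (- z * v) / z\<close> vanishes at infinity because
  \<open>Re z > 0\<close>, which leaves its boundary term at 0.\<close>

lemma has_bochner_integral_exp_halfline: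
  fixes z :: complex
  assumes "Re z > 0"
  shows "has_bochner_integral lborel (\<lambda>v::real. indicator {0<..} v *\<^sub>R exp (- z * of_real v)) (1 / z)"
proof -
  have int: "integrable lborel (\<lambda>v::real. indicator {0<..} v *\<^sub>R exp (- z * of_real v))"
  proof (rule Bochner_Integration.integrable_bound)
    show "integrable lborel (\<lambda>v::real. indicator {0<..} v *\<^sub>R exp (- (v * Re z)))"
      using integrable_I0i_exp_mscale[OF assms] by (simp add: set_integrable_def)
  qed (auto simp: indicator_def mult_ac)
  have "(LBINT v=0..\<infinity>. exp (- z * of_real v)) = 0 - (- 1 / z)"
  proof (rule interval_integral_FTC_integrable)
    show "((\<lambda>v::real. - exp (- z * of_real v) / z) has_vector_derivative exp (- z * of_real v)) (at v)" for v
      by (rule has_vector_derivative_real_field[where f = "\<lambda>w. - exp (- z * w) / z"])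
         (use assms in \<open>auto intro!: derivative_eq_intros\<close>)
    have "((\<lambda>v::real. - exp (- z * of_real v) / z) \<longlongrightarrow> - exp (- z * of_real 0) / z) (at_right 0)"
      using assms by (intro tendsto_intros) auto
    then show "(((\<lambda>v::real. - exp (- z * of_real v) / z) \<circ> real_of_ereal) \<longlongrightarrow> - 1 / z) (at_right 0)"
      by (simp add: zero_ereal_def ereal_tendsto_simps)
    have "((\<lambda>v::real. exp (- (Re z * v))) \<longlongrightarrow> 0) at_top"
      using assms by real_asymp
    then have "((\<lambda>v::real. norm (exp (- z * of_real v))) \<longlongrightarrow> 0) at_top" by simp
    then have "((\<lambda>v::real. exp (- z * of_real v)) \<longlongrightarrow> 0) at_top"
      by (rule tendsto_norm_zero_cancel)
    then have "((\<lambda>v::real. - exp (- z * of_real v) / z) \<longlongrightarrow> - 0 / z) at_top"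
      using assms by (intro tendsto_intros) auto
    then show "(((\<lambda>v::real. - exp (- z * of_real v) / z) \<circ> real_of_ereal) \<longlongrightarrow> 0) (at_left \<infinity>)"
      by (simp add: ereal_tendsto_simps)
    show "set_integrable lborel (einterval 0 \<infinity>) (\<lambda>v::real. exp (- z * of_real v))"
      using int by (simp add: set_integrable_def zero_ereal_def)
  qed (auto intro!: continuous_intros)
  then show ?thesis
    using int
    by (simp add: has_bochner_integral_iff interval_lebesgue_integral_0_infty set_lebesgue_integral_def)
qed

text \<open>Rescaling \<open>t\<close> by \<open>1 / \<sigma>\<close> reduces this to the derivative
  of the arctangent. Up to constants it is the majorant for the Perron integrands.\<close>

lemma integrable_inverse_sum_squares:
  fixes \<sigma> :: real
  assumes "\<sigma> > 0"
  shows "integrable lborel (\<lambda>t. 1 / (\<sigma>\<^sup>2 + t\<^sup>2))"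
proof -
  have "integrable lborel (\<lambda>t::real. inverse (1 + t\<^sup>2))"
    using integrable_inverse_1_plus_square by (simp add: set_integrable_def)
  then have "integrable lborel (\<lambda>t. inverse (1 + (0 + (1 / \<sigma>) * t)\<^sup>2) / \<sigma>\<^sup>2)"
    using assms by (intro integrable_divide_zero lborel_integrable_real_affine) auto
  also have "(\<lambda>t. inverse (1 + (0 + (1 / \<sigma>) * t)\<^sup>2) / \<sigma>\<^sup>2) = (\<lambda>t. 1 / (\<sigma>\<^sup>2 + t\<^sup>2))"
  proof
    fix t
    have "\<sigma>\<^sup>2 * (1 + (0 + (1 / \<sigma>) * t)\<^sup>2) = \<sigma>\<^sup>2 + t\<^sup>2"
      using assms by (simp add: power_divide distrib_left)
    then show "inverse (1 + (0 + (1 / \<sigma>) * t)\<^sup>2) / \<sigma>\<^sup>2 = 1 / (\<sigma>\<^sup>2 + t\<^sup>2)"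
      by (simp only: inverse_eq_divide divide_divide_eq_left mult.commute[of _ "\<sigma>\<^sup>2"])
  qed
  finally show ?thesis .
qed

lemma norm_Complex_sq: "(norm (Complex a b))\<^sup>2 = a\<^sup>2 + b\<^sup>2"
  by (simp add: cmod_def)

text \<open>For \<open>Re s > 0\<close> adding 1 moves \<open>s\<close> away from the origin, so the
  modulus of \<open>s * (s + 1)\<close> is at least that of \<open>s\<^sup>2\<close>. The bound is
  the weight in the tail integral of \<open>admissible\<close>.\<close>

lemma norm_perron_weight_le:
  assumes "\<sigma> > 0"
  shows "norm (1 / (Complex \<sigma> t * (Complex \<sigma> t + 1))) \<le> 1 / (\<sigma>\<^sup>2 + t\<^sup>2)"
proof -
  have "norm (Complex \<sigma> t) \<le> norm (Complex \<sigma> t + 1)"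
    using assms by (simp add: cmod_def power2_eq_square) (simp add: algebra_simps)
  then have "(norm (Complex \<sigma> t))\<^sup>2 \<le> norm (Complex \<sigma> t) * norm (Complex \<sigma> t + 1)"
    unfolding power2_eq_square by (rule mult_left_mono) simp
  moreover have "0 < \<sigma>\<^sup>2 + t\<^sup>2" using assms by (simp add: add_pos_nonneg)
  ultimately show ?thesis
    unfolding norm_Complex_sq by (simp add: norm_divide norm_mult frac_le)
qed

lemma measurable_Complex [measurable]: "(\<lambda>t. Complex \<sigma> t) \<in> borel_measurable borel"
  unfolding Complex_eq by measurable

text \<open>Fourier inversion of \<open>exp (- \<sigma> * v) * max 0 (1 - exp (- v))\<close>. The
  maximum cuts the function off for \<open>v \<le> 0\<close> and keeps it continuous at 0, as
  \<open>fourier_inversion\<close> demands.\<close>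

lemma perron_kernel:
  assumes "\<sigma> > 0"
  shows "(CLBINT t. 1 / (Complex \<sigma> t * (Complex \<sigma> t + 1)) * iexp (t * x)) =
    2 * of_real pi * of_real (exp (- \<sigma> * x) * max 0 (1 - exp (- x)))"
proof -
  define g where "g = (\<lambda>v. complex_of_real (exp (- \<sigma> * v) * max 0 (1 - exp (- v))))"
  have g_bound: "norm (g v) \<le> indicator {0<..} v * exp (- (v * \<sigma>))" for v
    unfolding g_def by (auto simp: indicator_def norm_mult mult_ac)
  have [measurable]: "g \<in> borel_measurable borel" unfolding g_def by measurable
  \<comment> \<open>The partial fractions \<open>1 / s - 1 / (s + 1)\<close> are the integrals of
    the half-line exponentials with rates \<open>s\<close> and \<open>s + 1\<close>, whose
    difference is the integrand.\<close>
  have transform: "has_bochner_integral lborel (\<lambda>v. g v * iexp (- (t * v)))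
      (1 / (Complex \<sigma> t * (Complex \<sigma> t + 1)))" for t
  proof -
    let ?s = "Complex \<sigma> t"
    have "has_bochner_integral lborel (\<lambda>v. indicator {0<..} v *\<^sub>R exp (- ?s * of_real v) -
        indicator {0<..} v *\<^sub>R exp (- (?s + 1) * of_real v)) (1 / ?s - 1 / (?s + 1))"
      using assms by (intro has_bochner_integral_diff has_bochner_integral_exp_halfline) auto
    also have "(\<lambda>v. indicator {0<..} v *\<^sub>R exp (- ?s * of_real v) -
        indicator {0<..} v *\<^sub>R exp (- (?s + 1) * of_real v)) = (\<lambda>v. g v * iexp (- (t * v)))"
    proof
      fix v
      have g_eq: "g v = indicator {0<..} v *\<^sub>R (exp (- of_real (\<sigma> * v)) * (1 - exp (- of_real v)))"
        unfolding g_def by (auto simp: indicator_def max_def exp_of_real[symmetric])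
      have e: "exp (- ?s * of_real v) = exp (- of_real (\<sigma> * v)) * iexp (- (t * v))"
        "exp (- (?s + 1) * of_real v) = exp (- of_real (\<sigma> * v)) * exp (- of_real v) * iexp (- (t * v))"
        unfolding exp_add[symmetric] by (simp_all add: Complex_eq algebra_simps)
      show "indicator {0<..} v *\<^sub>R exp (- ?s * of_real v) -
          indicator {0<..} v *\<^sub>R exp (- (?s + 1) * of_real v) = g v * iexp (- (t * v))"
        unfolding g_eq e scaleR_conv_of_real by (simp add: algebra_simps)
    qed
    also have "1 / ?s - 1 / (?s + 1) = 1 / (?s * (?s + 1))"
    proof -
      have "?s \<noteq> 0" "?s + 1 \<noteq> 0" using assms by (auto simp: complex_eq_iff)
      then show ?thesis by (simp add: field_simps)
    qed
    finally show ?thesis .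
  qed
  have h: "(\<lambda>t. CLBINT v. g v * iexp (- (t * v))) = (\<lambda>t. 1 / (Complex \<sigma> t * (Complex \<sigma> t + 1)))"
    using transform by (auto simp: has_bochner_integral_iff)
  have "(CLBINT t. (CLBINT v. g v * iexp (- (t * v))) * iexp (t * x)) = 2 * of_real pi * g x"
  proof (rule fourier_inversion)
    \<comment> \<open>At \<open>t = 0\<close> the factor \<open>iexp (- (t * v))\<close> is 1, so
      \<open>transform\<close> contains the integrability of \<open>g\<close> itself.\<close>
    show "integrable lborel g"
      using transform[of 0] by (simp add: has_bochner_integral_iff)
    show "continuous_on UNIV g" unfolding g_def by (intro continuous_intros)
    show "norm (g v) \<le> 1" for v
      by (rule order_trans[OF g_bound]) (use assms in \<open>auto simp: indicator_def\<close>)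
    show "integrable lborel (\<lambda>t. CLBINT v. g v * iexp (- (t * v)))"
      unfolding h
      by (rule Bochner_Integration.integrable_bound[OF integrable_inverse_sum_squares[OF assms]])
         (use norm_perron_weight_le[OF assms] in auto)
  qed
  then show ?thesis unfolding fun_cong[OF h] unfolding g_def .
qed

section \<open>Integrated coefficient sums\<close>

text \<open>A coefficient \<open>f n\<close> with \<open>n \<le> x\<close> is counted for
  \<open>u\<close> from \<open>n\<close> to \<open>x\<close>, so it contributes \<open>f n\<close>
  times the length \<open>x - n\<close>. The cut-off by \<open>max 0\<close> extends the finite sum
  to a series over all \<open>n\<close>, ready to be matched with Perron integrals term by
  term.\<close>

lemma coeff_sum_integral_sums:
  "(\<lambda>n. f (Suc n) * max 0 (x - real (Suc n))) sums coeff_sum_integral f x"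
proof -
  \<comment> \<open>\<open>nat\<close> sends a negative floor to 0, so \<open>{1..N}\<close> is
    empty for every \<open>x < 1\<close>.\<close>
  define N where "N = nat \<lfloor>x\<rfloor>"
  have N: "real n \<le> x \<longleftrightarrow> n \<le> N" if "n \<ge> 1" for n
    using that unfolding N_def by linarith
  have N': "real (Suc n) \<le> x \<longleftrightarrow> n < N" for n
    using N[of "Suc n"] by (simp add: Suc_le_eq)
  have "(\<lambda>n. f (Suc n) * max 0 (x - real (Suc n))) sums (\<Sum>n<N. f (Suc n) * max 0 (x - real (Suc n)))"
    using N' by (intro sums_finite) (auto simp: max_def simp del: of_nat_Suc)
  also have "(\<Sum>n<N. f (Suc n) * max 0 (x - real (Suc n))) = (\<Sum>n=1..N. f n * (x - real n))"
    unfolding One_nat_def sum.atLeast1_atMost_eq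
    using N' by (intro sum.cong) (auto simp: max_def simp del: of_nat_Suc)
  also have "\<dots> = coeff_sum_integral f x"
  proof (cases "1 \<le> x")
    case True
    have cs: "coeff_sum f u = (\<Sum>n=1..N. indicator {real n..} u * f n)" if "u \<in> {1..x}" for u
    proof -
      have "n \<le> N" if "1 \<le> n" "real n \<le> u" for n
        using N[of n] that \<open>u \<in> {1..x}\<close> by simp
      then have "{n. 1 \<le> n \<and> real n \<le> u} = {n \<in> {1..N}. real n \<le> u}" by auto
      then show ?thesis
        unfolding coeff_sum_def by (simp only: sum.inter_filter finite_atLeastAtMost)
          (intro sum.cong refl, simp add: indicator_def)
    qed
    have "coeff_sum_integral f x = (LBINT u:{1..x}. coeff_sum f u)"
      unfolding coeff_sum_integral_def one_ereal_def using True by (subst interval_integral_Icc) auto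
    also have "\<dots> = (LBINT u. (\<Sum>n=1..N. indicator {real n..x} u * f n))"
      unfolding set_lebesgue_integral_def
    proof (intro Bochner_Integration.integral_cong refl)
      fix u
      show "indicator {1..x} u *\<^sub>R coeff_sum f u = (\<Sum>n=1..N. indicator {real n..x} u * f n)"
      proof (cases "u \<in> {1..x}")
        case True
        then show ?thesis by (simp only: cs) (simp add: indicator_def)
      next
        case False
        then have "indicator {real n..x} u * f n = 0" if "n \<in> {1..N}" for n
          using that by (auto simp: indicator_def)
        then show ?thesis using False by (simp add: sum.neutral)
      qed
    qed
    also have "\<dots> = (\<Sum>n=1..N. LBINT u. indicator {real n..x} u * f n)"
      by (rule Bochner_Integration.integral_sum)
         (auto intro!: integrable_mult_left integrable_real_indicator
            emeasure_lborel_Icc_eq[THEN ord_eq_less_trans])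
    also have "\<dots> = (\<Sum>n=1..N. f n * (x - real n))"
    proof (intro sum.cong refl)
      fix n assume "n \<in> {1..N}"
      then have "real n \<le> x" using N[of n] by simp
      then show "(LBINT u. indicator {real n..x} u * f n) = f n * (x - real n)"
        by simp
    qed
    finally show ?thesis by simp
  next
    case False
    \<comment> \<open>For \<open>x < 1\<close> the oriented integral is minus the integral over
      \<open>{x<..<1}\<close>, where \<open>coeff_sum\<close> is an empty sum.\<close>
    then have "coeff_sum_integral f x = - (LBINT u:{x<..<1}. coeff_sum f u)"
      by (simp add: coeff_sum_integral_def interval_lebesgue_integral_def one_ereal_def)
    moreover have "coeff_sum f u = 0" if "u \<in> {x<..<1}" for u
    proof -
      have "{n. 1 \<le> n \<and> real n \<le> u} = {}" using that by auto
      then show ?thesis by (simp only: coeff_sum_def sum.empty)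
    qed
    then have "(LBINT u:{x<..<1}. coeff_sum f u) = 0"
      unfolding set_lebesgue_integral_def
      by (intro integral_eq_zero_AE AE_I2) (auto simp: indicator_def)
    moreover have "N = 0" using False unfolding N_def by linarith
    ultimately show ?thesis by simp
  qed
  finally show ?thesis .
qed

section \<open>The series on a vertical line\<close>

text \<open>On a vertical line only an oscillation of frequency \<open>- ln (Suc n)\<close> depends
  on \<open>t\<close>. Isolating it lets it merge with \<open>iexp (t * ln x)\<close> in Perron's
  formula.\<close>

lemma dirichlet_term_line:
  "dirichlet_term f (Complex \<sigma> t) n =
    of_real (f (Suc n) * exp (- \<sigma> * ln (Suc n))) * iexp (t * - ln (Suc n))"
proof -
  have "of_nat (Suc n) powr - Complex \<sigma> t = exp (- Complex \<sigma> t * of_real (ln (Suc n)))"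
    unfolding powr_def using Ln_of_real[of "real (Suc n)"] by (simp del: of_nat_Suc)
  also have "- Complex \<sigma> t * of_real (ln (Suc n)) =
      of_real (- \<sigma> * ln (Suc n)) + \<i> * of_real (t * - ln (Suc n))"
    by (simp add: Complex_eq algebra_simps)
  also have "exp \<dots> = of_real (exp (- \<sigma> * ln (Suc n))) * iexp (t * - ln (Suc n))"
    by (simp only: exp_add exp_of_real)
  finally show ?thesis by (simp only: dirichlet_term_def of_real_mult mult.assoc)
qed

text \<open>The definition of the abscissa provides a point \<open>s0\<close> further left with
  absolute convergence. Comparison at \<open>t = 0\<close> suffices, as the moduli of the terms are
  constant along the line.\<close>

lemma summable_dirichlet_coeff:
  assumes "of_real \<sigma> \<in> conv_half_plane f"
  shows "summable (\<lambda>n. \<bar>f (Suc n) * exp (- \<sigma> * ln (Suc n))\<bar>)"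
proof -
  obtain s0 where s0: "Re s0 < Re (of_real \<sigma>)" "summable (\<lambda>n. norm (dirichlet_term f s0 n))"
    using summable_dirichlet_term[OF assms] .
  show ?thesis
  proof (rule summable_comparison_test'[OF s0(2), of 0])
    fix n
    have "norm (dirichlet_term f (Complex \<sigma> 0) n) \<le> norm (dirichlet_term f s0 n)"
      using s0(1) by (intro norm_dirichlet_term_mono) simp
    then show "norm \<bar>f (Suc n) * exp (- \<sigma> * ln (Suc n))\<bar> \<le> norm (dirichlet_term f s0 n)"
      by (simp add: dirichlet_term_line norm_mult abs_mult del: of_nat_Suc)
  qed
qed

lemma Complex_in_conv_half_plane:
  "of_real \<sigma> \<in> conv_half_plane f \<Longrightarrow> Complex \<sigma> t \<in> conv_half_plane f"
  by (simp add: conv_half_plane_def)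

lemma norm_dirichlet_series_line_le:
  assumes "of_real \<sigma> \<in> conv_half_plane f"
  shows "norm (dirichlet_series f (Complex \<sigma> t)) \<le> (\<Sum>n. \<bar>f (Suc n) * exp (- \<sigma> * ln (Suc n))\<bar>)"
proof -
  have eq: "norm (dirichlet_term f (Complex \<sigma> t) n) = \<bar>f (Suc n) * exp (- \<sigma> * ln (Suc n))\<bar>" for n
    by (simp add: dirichlet_term_line norm_mult abs_mult del: of_nat_Suc)
  show ?thesis
    using summable_norm[of "dirichlet_term f (Complex \<sigma> t)"] summable_dirichlet_coeff[OF assms]
    unfolding eq dirichlet_series_def by simp
qed

lemma measurable_dirichlet_series_line:
  assumes "abscissa f = ereal \<alpha>" "\<sigma> > \<alpha>"
  shows "(\<lambda>t. dirichlet_series f (Complex \<sigma> t)) \<in> borel_measurable borel"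
proof (rule borel_measurable_continuous_onI)
  have "continuous_on UNIV (\<lambda>t. Complex \<sigma> t)"
    unfolding Complex_eq by (intro continuous_intros)
  moreover have "continuous_on (conv_half_plane f) (dirichlet_series f)"
    by (intro holomorphic_on_imp_continuous_on dirichlet_series_holomorphic[OF assms(1)])
  moreover have "range (\<lambda>t. Complex \<sigma> t) \<subseteq> conv_half_plane f"
    using assms by (auto simp: conv_half_plane_eq)
  ultimately show "continuous_on UNIV (\<lambda>t. dirichlet_series f (Complex \<sigma> t))"
    by (metis continuous_on_compose2)
qed

text \<open>The series is bounded on the line by its sum of absolute values, so the weight alone
  gives integrability. Restricted to large \<open>t\<close>, this is the tail integral of
  \<open>admissible\<close>.\<close>

lemma integrable_dirichlet_series_line:
  assumes "abscissa f = ereal \<alpha>" "\<sigma> > \<alpha>" "\<sigma> > 0"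
  shows "integrable lborel (\<lambda>t. norm (dirichlet_series f (Complex \<sigma> t)) / (\<sigma>\<^sup>2 + t\<^sup>2))"
proof (rule Bochner_Integration.integrable_bound)
  define C where "C = (\<Sum>n. \<bar>f (Suc n) * exp (- \<sigma> * ln (Suc n))\<bar>)"
  note [measurable] = measurable_dirichlet_series_line[OF assms(1,2)]
  show "integrable lborel (\<lambda>t. C * (1 / (\<sigma>\<^sup>2 + t\<^sup>2)))"
    by (intro integrable_mult_right integrable_inverse_sum_squares assms)
  show "(\<lambda>t. norm (dirichlet_series f (Complex \<sigma> t)) / (\<sigma>\<^sup>2 + t\<^sup>2)) \<in> borel_measurable lborel"
    by measurable
  have "of_real \<sigma> \<in> conv_half_plane f" using assms by (simp add: conv_half_plane_eq)
  then have le: "norm (dirichlet_series f (Complex \<sigma> t)) \<le> \<bar>C\<bar>" for t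
    using norm_dirichlet_series_line_le[of \<sigma> f t] unfolding C_def by linarith
  show "AE t in lborel. norm (norm (dirichlet_series f (Complex \<sigma> t)) / (\<sigma>\<^sup>2 + t\<^sup>2)) \<le>
      norm (C * (1 / (\<sigma>\<^sup>2 + t\<^sup>2)))"
    unfolding norm_mult norm_divide by (rule AE_I2) (simp add: divide_right_mono le)
qed

text \<open>Insert the series, integrate term by term and evaluate each term by
  \<open>perron_kernel\<close> at \<open>ln x - ln (Suc n)\<close>; the results add up by
  \<open>coeff_sum_integral_sums\<close>. Absolute convergence and the integrable weight justify the
  exchange.\<close>

theorem perron_formula:
  assumes \<sigma>: "of_real \<sigma> \<in> conv_half_plane f" "\<sigma> > 0" and x: "x > 0"
  shows "(CLBINT t. dirichlet_series f (Complex \<sigma> t) / (Complex \<sigma> t * (Complex \<sigma> t + 1)) *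
      iexp (t * ln x)) = of_real (2 * pi * x powr (- \<sigma> - 1) * coeff_sum_integral f x)"
proof -
  define c where "c = (\<lambda>n. f (Suc n) * exp (- \<sigma> * ln (Suc n)))"
  define w where "w = (\<lambda>t. 1 / (Complex \<sigma> t * (Complex \<sigma> t + 1)))"
  define T where "T = (\<lambda>n t. of_real (c n) * (w t * iexp (t * (ln x - ln (Suc n)))))"
  have [measurable]: "w \<in> borel_measurable borel" unfolding w_def by measurable
  have w: "integrable lborel w"
    by (rule Bochner_Integration.integrable_bound[OF integrable_inverse_sum_squares[OF \<sigma>(2)]])
       (use norm_perron_weight_le[OF \<sigma>(2)] in \<open>auto simp: w_def\<close>)
  have normT: "norm (T n t) = \<bar>c n\<bar> * norm (w t)" for n t
    by (simp add: T_def norm_mult del: of_nat_Suc)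
  have c: "summable (\<lambda>n. \<bar>c n\<bar>)"
    unfolding c_def by (rule summable_dirichlet_coeff[OF \<sigma>(1)])
  have "(\<lambda>n. T n t) sums
      (dirichlet_series f (Complex \<sigma> t) / (Complex \<sigma> t * (Complex \<sigma> t + 1)) * iexp (t * ln x))" for t
  proof -
    have "(\<lambda>n. dirichlet_term f (Complex \<sigma> t) n * (w t * iexp (t * ln x))) sums
        (dirichlet_series f (Complex \<sigma> t) * (w t * iexp (t * ln x)))"
      by (intro sums_mult2 dirichlet_series_sums Complex_in_conv_half_plane \<sigma>)
    moreover have "dirichlet_term f (Complex \<sigma> t) n * (w t * iexp (t * ln x)) = T n t" for n
    proof -
      have eq: "iexp (t * (ln x - ln (Suc n))) = iexp (t * - ln (Suc n)) * iexp (t * ln x)"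
        unfolding exp_add[symmetric] by (simp add: algebra_simps del: of_nat_Suc)
      show ?thesis
        unfolding dirichlet_term_line T_def c_def eq by (simp only: mult_ac)
    qed
    ultimately show ?thesis by (simp add: w_def)
  qed
  then have series: "(\<lambda>t. dirichlet_series f (Complex \<sigma> t) / (Complex \<sigma> t * (Complex \<sigma> t + 1)) *
      iexp (t * ln x)) = (\<lambda>t. \<Sum>n. T n t)"
    by (auto simp: sums_iff)
  have T: "integrable lborel (T n)" for n
    by (rule Bochner_Integration.integrable_bound[of _ "\<lambda>t. \<bar>c n\<bar> * norm (w t)"])
       (use w in \<open>auto simp: normT T_def norm_mult\<close>)
  have "(CLBINT t. (\<Sum>n. T n t)) = (\<Sum>n. CLBINT t. T n t)"
  proof (rule integral_suminf)
    show "AE t in lborel. summable (\<lambda>n. norm (T n t))"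
      unfolding normT by (intro AE_I2 summable_mult2 c)
    show "summable (\<lambda>n. LBINT t. norm (T n t))"
      unfolding normT using c by (simp add: summable_mult2)
  qed (rule T)
  also have "(\<lambda>n. CLBINT t. T n t) = (\<lambda>n. of_real (2 * pi * x powr (- \<sigma> - 1) *
      (f (Suc n) * max 0 (x - real (Suc n)))))"
  proof
    fix n
    let ?m = "real (Suc n)"
    \<comment> \<open>The kernel at \<open>ln x - ln ?m\<close> contains
      \<open>max 0 (1 - ?m / x)\<close>. Its denominator \<open>x\<close> lowers the power of
      \<open>x\<close> from \<open>- \<sigma>\<close> to \<open>- \<sigma> - 1\<close>.\<close>
    have "exp (- (ln x - ln ?m)) = ?m / x"
      using x by (simp add: exp_diff del: of_nat_Suc)
    then have "max 0 (1 - exp (- (ln x - ln ?m))) = max 0 (x - ?m) / x"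
      using x by (simp add: max_def field_simps del: of_nat_Suc)
    moreover have "exp (- \<sigma> * ln ?m) * exp (- \<sigma> * (ln x - ln ?m)) = x powr (- \<sigma>)"
      using x unfolding exp_add[symmetric] by (simp add: powr_def algebra_simps del: of_nat_Suc)
    moreover have "x powr (- \<sigma> - 1) = x powr (- \<sigma>) / x"
      using x by (simp add: powr_diff)
    ultimately have "c n * (2 * pi * (exp (- \<sigma> * (ln x - ln ?m)) * max 0 (1 - exp (- (ln x - ln ?m))))) =
        2 * pi * x powr (- \<sigma> - 1) * (f (Suc n) * max 0 (x - ?m))"
      unfolding c_def by (simp only: mult_ac times_divide_eq_right times_divide_eq_left)
    moreover have "(CLBINT t. T n t) =
        of_real (c n * (2 * pi * (exp (- \<sigma> * (ln x - ln ?m)) * max 0 (1 - exp (- (ln x - ln ?m))))))"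
      unfolding T_def w_def
      by (subst integral_mult_right_zero, subst perron_kernel[OF \<sigma>(2)])
         (simp only: of_real_mult of_real_numeral)
    ultimately show "(CLBINT t. T n t) = of_real (2 * pi * x powr (- \<sigma> - 1) *
        (f (Suc n) * max 0 (x - ?m)))"
      by (simp only:)
  qed
  also have "(\<Sum>n. of_real (2 * pi * x powr (- \<sigma> - 1) * (f (Suc n) * max 0 (x - real (Suc n))))) =
      (of_real (2 * pi * x powr (- \<sigma> - 1) * coeff_sum_integral f x) :: complex)"
    by (intro sums_unique[symmetric] sums_of_real sums_mult coeff_sum_integral_sums)
  finally show ?thesis unfolding series .
qed

section \<open>The saddle point estimate\<close>

text \<open>Scaled to be 1 at \<open>t = 0\<close>, the weight is a product of factors
  \<open>r / (r + i t)\<close> for \<open>r = \<sigma>\<close> and \<open>r = \<sigma> + 1\<close>,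
  each of modulus at most 1 and within \<open>\<bar>t\<bar> / \<sigma>\<close> of 1. The first two
  bounds serve small \<open>t\<close>, the third the tail.\<close>

lemma perron_weight_bounds:
  fixes \<sigma> t :: real
  assumes "\<sigma> > 0"
  defines "W \<equiv> of_real (\<sigma> * (\<sigma> + 1)) / (Complex \<sigma> t * (Complex \<sigma> t + 1))"
  shows "norm W \<le> 1" "norm (W - 1) \<le> 2 * \<bar>t\<bar> / \<sigma>"
    "norm W \<le> \<sigma> * (\<sigma> + 1) / (\<sigma>\<^sup>2 + t\<^sup>2)"
proof -
  let ?q = "\<lambda>r. of_real r / Complex r t"
  have q1: "norm (?q r) \<le> 1" and q2: "norm (?q r - 1) \<le> \<bar>t\<bar> / \<sigma>" if "r \<ge> \<sigma>" for r
  proof -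
    have r: "r > 0" "Complex r t \<noteq> 0" using that assms by (auto simp: complex_eq_iff)
    have r_le: "r \<le> norm (Complex r t)" using complex_Re_le_cmod[of "Complex r t"] by simp
    have pos: "norm (Complex r t) > 0" using r by simp
    show "norm (?q r) \<le> 1"
      using r r_le pos by (simp add: norm_divide)
    have "?q r - 1 = - \<i> * of_real t / Complex r t"
      using r(2) by (simp add: divide_simps) (simp add: Complex_eq)
    then have "norm (?q r - 1) = \<bar>t\<bar> / norm (Complex r t)"
      by (simp add: norm_divide norm_mult)
    also have "\<dots> \<le> \<bar>t\<bar> / \<sigma>"
      using assms that r_le by (intro divide_left_mono mult_pos_pos pos) auto
    finally show "norm (?q r - 1) \<le> \<bar>t\<bar> / \<sigma>" .
  qed
  have "Complex \<sigma> t + 1 = Complex (\<sigma> + 1) t" by (simp add: complex_eq_iff)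
  then have W: "W = ?q \<sigma> * ?q (\<sigma> + 1)" by (simp add: W_def)
  show "norm W \<le> 1"
    unfolding W norm_mult using q1[of \<sigma>] q1[of "\<sigma> + 1"] by (intro mult_le_one) auto
  \<comment> \<open>Replacing the factors by 1 one at a time makes their errors add.\<close>
  have "W - 1 = (?q \<sigma> - 1) * ?q (\<sigma> + 1) + (?q (\<sigma> + 1) - 1)"
    unfolding W by (simp only: algebra_simps mult_1)
  also have "norm \<dots> \<le> norm (?q \<sigma> - 1) * norm (?q (\<sigma> + 1)) + norm (?q (\<sigma> + 1) - 1)"
    unfolding norm_mult[symmetric] by (rule norm_triangle_ineq)
  also have "\<dots> \<le> \<bar>t\<bar> / \<sigma> * 1 + \<bar>t\<bar> / \<sigma>"
    using assms q1[of "\<sigma> + 1"] q2[of \<sigma>] q2[of "\<sigma> + 1"] by (intro add_mono mult_mono) auto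
  finally show "norm (W - 1) \<le> 2 * \<bar>t\<bar> / \<sigma>" by simp
  have "norm W = \<sigma> * (\<sigma> + 1) * norm (1 / (Complex \<sigma> t * (Complex \<sigma> t + 1)))"
    using assms by (simp add: W_def norm_divide norm_mult)
  also have "\<dots> \<le> \<sigma> * (\<sigma> + 1) * (1 / (\<sigma>\<^sup>2 + t\<^sup>2))"
    using assms by (intro mult_left_mono norm_perron_weight_le) auto
  finally show "norm W \<le> \<sigma> * (\<sigma> + 1) / (\<sigma>\<^sup>2 + t\<^sup>2)" by simp
qed

lemma dirichlet_series_real_axis:
  assumes "\<forall>n\<ge>1. f n \<ge> 0" "f 1 > 0" "of_real \<sigma> \<in> conv_half_plane f"
  shows "F_real f \<sigma> > 0" "dirichlet_series f (of_real \<sigma>) = of_real (F_real f \<sigma>)"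
  using dirichlet_series_real_pos[OF assms] by (auto simp: F_real_def)

text \<open>Exponentiating the definition of the remainder gives an exact identity, in which the
  deviation from the Gaussian model sits in the last factor alone.\<close>

lemma dirichlet_series_line_eq:
  assumes coeffs: "\<forall>n\<ge>1. f n \<ge> 0" "f 1 > 0"
    and absc: "abscissa f = ereal \<alpha>"
    and nz: "\<forall>s. Re s > \<alpha> \<longrightarrow> dirichlet_series f s \<noteq> 0"
    and \<sigma>: "\<sigma> > \<alpha>"
  shows "dirichlet_series f (Complex \<sigma> t) =
    of_real (F_real f \<sigma>) * iexp (a_fun f \<sigma> * t) * of_real (exp (- b_fun f \<sigma> * t\<^sup>2 / 2)) *
    exp (log_remainder f \<sigma> t)"
proof -
  let ?H = "dirichlet_log f"
  have H: "dirichlet_series f s = exp (?H s)" if "Re s > \<alpha>" for s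
    using dirichlet_log_exists[OF coeffs absc nz] that
    unfolding is_dirichlet_log_def conv_half_plane_eq[OF absc] by blast
  have "?H (Complex \<sigma> t) = ?H (of_real \<sigma>) + \<i> * of_real (a_fun f \<sigma> * t) +
      of_real (- b_fun f \<sigma> * t\<^sup>2 / 2) + log_remainder f \<sigma> t"
    by (simp add: log_remainder_def)
  then have "exp (?H (Complex \<sigma> t)) = exp (?H (of_real \<sigma>)) * iexp (a_fun f \<sigma> * t) *
      of_real (exp (- b_fun f \<sigma> * t\<^sup>2 / 2)) * exp (log_remainder f \<sigma> t)"
    by (simp only: exp_add exp_of_real)
  moreover have "exp (?H (of_real \<sigma>)) = of_real (F_real f \<sigma>)"
    using H[of "of_real \<sigma>"] dirichlet_series_real_axis(2)[OF coeffs, of \<sigma>] \<sigma>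
    by (simp add: conv_half_plane_eq[OF absc])
  ultimately show ?thesis using H[of "Complex \<sigma> t"] \<sigma> by simp
qed

text \<open>Integrating a pointwise bound for the distance between the normalised Perron integrand
  and its Gaussian model gives four errors: the remainder for small \<open>t\<close>, the variation
  of the weight, the Gaussian tail and the tail of the series. The bound is free of
  \<open>x\<close>, which enters the integrands only through the unimodular
  \<open>iexp (t * ln x)\<close>.\<close>

lemma saddle_point_bound:
  fixes f :: "nat \<Rightarrow> real" and \<alpha> \<sigma> \<delta> \<epsilon> x :: real
  defines "a \<equiv> a_fun f \<sigma>" and "b \<equiv> b_fun f \<sigma>" and "\<Phi> \<equiv> F_real f \<sigma>"
    and "J \<equiv> LBINT t:{t. \<bar>t\<bar> \<ge> \<delta>}. norm (dirichlet_series f (Complex \<sigma> t)) / (\<sigma>\<^sup>2 + t\<^sup>2)"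
  assumes coeffs: "\<forall>n\<ge>1. f n \<ge> 0" "f 1 > 0"
    and absc: "abscissa f = ereal \<alpha>"
    and nz: "\<forall>s. Re s > \<alpha> \<longrightarrow> dirichlet_series f s \<noteq> 0"
    and \<sigma>: "\<sigma> > \<alpha>" "\<sigma> > 0" and b: "b > 0" and x: "x > 0" and \<delta>: "\<delta> > 0"
    and rem: "\<And>t. \<bar>t\<bar> \<le> \<delta> \<Longrightarrow> norm (exp (log_remainder f \<sigma> t) - 1) \<le> \<epsilon>"
  shows "\<bar>coeff_sum_integral f x * (\<sigma> * (\<sigma> + 1) * sqrt (2 * pi * b)) / (x powr (\<sigma> + 1) * \<Phi>) -
      exp (- (a + ln x)\<^sup>2 / (2 * b))\<bar> \<le>
    \<epsilon> + 4 / sqrt (2 * pi) / (\<sigma> * sqrt b) + sqrt 2 * exp (- b * \<delta>\<^sup>2 / 4) +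
    (\<sigma> + 1) / sqrt (2 * pi) * (\<sigma> * sqrt b / \<Phi> * J)"
proof -
  define F where "F = (\<lambda>t. dirichlet_series f (Complex \<sigma> t))"
  define W where "W = (\<lambda>t. of_real (\<sigma> * (\<sigma> + 1)) / (Complex \<sigma> t * (Complex \<sigma> t + 1)))"
  define N where "N = (\<lambda>(c::real) (t::real). exp (- c * t\<^sup>2 / 2))"
  \<comment> \<open>\<open>P\<close> is the Perron integrand scaled to be 1 at \<open>t = 0\<close>,
    and \<open>E\<close> is its Gaussian model.\<close>
  define P where "P = (\<lambda>t. F t * W t * iexp (t * ln x) / of_real \<Phi>)"
  define E where "E = (\<lambda>t. iexp ((a + ln x) * t) * complex_of_real (N b t))"
  define Fw where "Fw = (\<lambda>t. norm (F t) / (\<sigma>\<^sup>2 + t\<^sup>2))"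
  define I where "I = (\<lambda>t. indicator {t. \<bar>t\<bar> \<ge> \<delta>} t * Fw t)"
  \<comment> \<open>One majorant for all \<open>t\<close>: the first two terms cover
    \<open>\<bar>t\<bar> \<le> \<delta>\<close>, the last two the complement. All four are
    nonnegative, so their sum is valid on both ranges.\<close>
  define U where "U = (\<lambda>t. \<epsilon> * N b t + 2 / \<sigma> * (\<bar>t\<bar> * N b t) + exp (- b * \<delta>\<^sup>2 / 4) * N (b / 2) t +
      \<sigma> * (\<sigma> + 1) / \<Phi> * I t)"
  have S: "of_real \<sigma> \<in> conv_half_plane f" using \<sigma> by (simp add: conv_half_plane_eq[OF absc])
  have \<Phi>: "\<Phi> > 0" unfolding \<Phi>_def by (rule dirichlet_series_real_axis(1)[OF coeffs S])
  have \<epsilon>: "\<epsilon> \<ge> 0" using order_trans[OF norm_ge_zero rem[of 0]] \<delta> by simp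
  have W: "norm (W t) \<le> 1" "norm (W t - 1) \<le> 2 * \<bar>t\<bar> / \<sigma>"
    "norm (W t) \<le> \<sigma> * (\<sigma> + 1) / (\<sigma>\<^sup>2 + t\<^sup>2)" for t
    unfolding W_def by (intro perron_weight_bounds \<sigma>)+
  have [measurable]: "F \<in> borel_measurable borel"
    unfolding F_def by (rule measurable_dirichlet_series_line[OF absc \<sigma>(1)])
  have [measurable]: "W \<in> borel_measurable borel" unfolding W_def by measurable
  have Fw: "integrable lborel Fw"
    unfolding Fw_def F_def by (rule integrable_dirichlet_series_line[OF absc \<sigma>])
  have I: "integrable lborel I"
  proof -
    have "{t. \<bar>t\<bar> \<ge> \<delta>} \<in> sets lborel" by measurable
    then show ?thesis
      unfolding I_def using integrable_mult_indicator[OF _ Fw] by simp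
  qed
  have N: "integrable lborel (N c)" "integral\<^sup>L lborel (N c) = sqrt (2 * pi / c)"
    "integrable lborel (\<lambda>t. \<bar>t\<bar> * N c t)" "(LBINT t. \<bar>t\<bar> * N c t) = 2 / c" if "c > 0" for c
    using has_bochner_integral_gaussian[OF that] has_bochner_integral_gaussian_abs[OF that]
    by (auto simp: N_def has_bochner_integral_iff)
  have Fw_nonneg: "Fw t \<ge> 0" for t by (simp add: Fw_def)
  have normP: "norm (P t) \<le> \<sigma> * (\<sigma> + 1) / \<Phi> * Fw t" for t
  proof -
    have "norm (P t) = norm (F t) / \<Phi> * norm (W t)"
      using \<Phi> by (simp add: P_def norm_divide norm_mult)
    also have "\<dots> \<le> norm (F t) / \<Phi> * (\<sigma> * (\<sigma> + 1) / (\<sigma>\<^sup>2 + t\<^sup>2))"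
      using \<Phi> by (intro mult_left_mono W) auto
    finally show ?thesis by (simp add: Fw_def mult_ac)
  qed
  have P: "integrable lborel P"
  proof (rule Bochner_Integration.integrable_bound)
    show "integrable lborel (\<lambda>t. \<sigma> * (\<sigma> + 1) / \<Phi> * Fw t)" using Fw by simp
    show "P \<in> borel_measurable lborel" unfolding P_def by measurable
    show "AE t in lborel. norm (P t) \<le> norm (\<sigma> * (\<sigma> + 1) / \<Phi> * Fw t)"
      using normP abs_ge_self order_trans by (intro AE_I2) fastforce
  qed
  have E: "integrable lborel E"
    by (rule Bochner_Integration.integrable_bound[OF N(1)[OF b]]) (auto simp: E_def N_def norm_mult)
  have U: "integrable lborel U"
    unfolding U_def using b N I
    by (intro Bochner_Integration.integrable_add integrable_mult_right) auto
  have P_eq: "P t = E t * (exp (log_remainder f \<sigma> t) * W t)" for t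
  proof -
    have "iexp (a * t) * iexp (t * ln x) = iexp ((a + ln x) * t)"
      unfolding exp_add[symmetric] by (simp add: algebra_simps)
    then show ?thesis
      using \<Phi> unfolding P_def F_def E_def N_def dirichlet_series_line_eq[OF coeffs absc nz \<sigma>(1)]
        a_def[symmetric] b_def[symmetric] \<Phi>_def[symmetric]
      by (simp add: mult_ac)
  qed
  have pointwise: "norm (P t - E t) \<le> U t" for t
  proof (cases "\<bar>t\<bar> \<le> \<delta>")
    case True
    let ?e = "exp (log_remainder f \<sigma> t)"
    \<comment> \<open>The product of remainder factor and weight is compared with 1 one factor at a
      time.\<close>
    have "P t - E t = E t * ((?e - 1) * W t + (W t - 1))"
      unfolding P_eq by (simp add: algebra_simps)
    also have "norm \<dots> = N b t * norm ((?e - 1) * W t + (W t - 1))"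
      by (simp add: E_def N_def norm_mult)
    also have "\<dots> \<le> N b t * (norm (?e - 1) * norm (W t) + norm (W t - 1))"
      unfolding norm_mult[symmetric] by (intro mult_left_mono norm_triangle_ineq) (simp add: N_def)
    also have "\<dots> \<le> N b t * (\<epsilon> * 1 + 2 * \<bar>t\<bar> / \<sigma>)"
      using rem[OF True] W \<epsilon> by (intro mult_left_mono add_mono mult_mono) (auto simp: N_def)
    also have "\<dots> \<le> U t"
      using \<sigma> \<Phi> Fw_nonneg[of t] by (auto simp: U_def I_def N_def algebra_simps indicator_def)
    finally show ?thesis .
  next
    case False
    have "norm (P t - E t) \<le> norm (P t) + norm (E t)" by (rule norm_triangle_ineq4)
    also have "norm (P t) \<le> \<sigma> * (\<sigma> + 1) / \<Phi> * I t"
      using normP[of t] False by (simp add: I_def)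
    \<comment> \<open>Only half of the Gaussian exponent is estimated by its value at
      \<open>\<delta>\<close>; the other half stays as \<open>N (b / 2)\<close> to be
      integrated.\<close>
    also have "norm (E t) \<le> exp (- b * \<delta>\<^sup>2 / 4) * N (b / 2) t"
    proof -
      have "\<delta>\<^sup>2 \<le> t\<^sup>2" using False \<delta> by (simp add: abs_le_square_iff[symmetric])
      then have "b * \<delta>\<^sup>2 \<le> b * t\<^sup>2" using b by simp
      then show ?thesis
        by (simp add: E_def N_def norm_mult exp_add[symmetric])
    qed
    also have "\<sigma> * (\<sigma> + 1) / \<Phi> * I t + exp (- b * \<delta>\<^sup>2 / 4) * N (b / 2) t \<le> U t"
      using \<epsilon> \<sigma> by (simp add: U_def N_def)
    finally show ?thesis by simp
  qed
  have "(CLBINT t. P t) = of_real (\<sigma> * (\<sigma> + 1) / \<Phi>) *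
      (CLBINT t. F t / (Complex \<sigma> t * (Complex \<sigma> t + 1)) * iexp (t * ln x))"
    by (subst integral_mult_right_zero[symmetric]) (simp add: P_def W_def mult_ac)
  also have "\<dots> = of_real (\<sigma> * (\<sigma> + 1) / \<Phi> * (2 * pi * x powr (- \<sigma> - 1) * coeff_sum_integral f x))"
    unfolding F_def perron_formula[OF S \<sigma>(2) x] by (simp only: of_real_mult)
  finally have intP: "(CLBINT t. P t) =
      of_real (\<sigma> * (\<sigma> + 1) / \<Phi> * (2 * pi * x powr (- \<sigma> - 1) * coeff_sum_integral f x))" .
  have intE: "(CLBINT t. E t) = of_real (sqrt (2 * pi / b) * exp (- (a + ln x)\<^sup>2 / (2 * b)))"
    unfolding E_def N_def by (rule gaussian_fourier[OF b])
  have intI: "(LBINT t. I t) = J"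
    by (simp add: I_def J_def Fw_def F_def set_lebesgue_integral_def)
  have intU: "(LBINT t. U t) = \<epsilon> * sqrt (2 * pi / b) + 2 / \<sigma> * (2 / b) +
      exp (- b * \<delta>\<^sup>2 / 4) * sqrt (2 * pi / (b / 2)) + \<sigma> * (\<sigma> + 1) / \<Phi> * J"
    unfolding U_def using b N I intI by simp
  \<comment> \<open>\<open>?k\<close> is the reciprocal of the Gaussian mass
    \<open>sqrt (2 * pi / b)\<close>, so multiplying by it turns the model integral into
    \<open>?G\<close>.\<close>
  let ?k = "sqrt (b / (2 * pi))"
  let ?Q = "\<sigma> * (\<sigma> + 1) / \<Phi> * (2 * pi * x powr (- \<sigma> - 1) * coeff_sum_integral f x)"
  let ?G = "exp (- (a + ln x)\<^sup>2 / (2 * b))"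
  have "\<bar>?Q - sqrt (2 * pi / b) * ?G\<bar> = norm ((CLBINT t. P t) - (CLBINT t. E t))"
    unfolding intP intE of_real_diff[symmetric] norm_of_real ..
  also have "\<dots> = norm (CLBINT t. P t - E t)" using P E by simp
  also have "\<dots> \<le> (LBINT t. U t)"
  proof (rule order_trans[OF integral_norm_bound])
    show "(LBINT t. norm (P t - E t)) \<le> (LBINT t. U t)"
      using P E U pointwise by (intro integral_mono) auto
  qed
  finally have "\<bar>?Q - sqrt (2 * pi / b) * ?G\<bar> \<le> (LBINT t. U t)" .
  then have bound: "?k * \<bar>?Q - sqrt (2 * pi / b) * ?G\<bar> \<le> ?k * (LBINT t. U t)"
    using b by (intro mult_left_mono) auto
  have expand: "?k * \<bar>?Q - sqrt (2 * pi / b) * ?G\<bar> = \<bar>?k * ?Q - ?k * sqrt (2 * pi / b) * ?G\<bar>"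
  proof -
    have "?k * \<bar>z\<bar> = \<bar>?k * z\<bar>" for z using b by (simp add: abs_mult)
    then show ?thesis by (simp only: right_diff_distrib mult.assoc)
  qed
  have k1: "?k * sqrt (2 * pi / b) = 1"
    using b by (simp add: real_sqrt_mult[symmetric])
  have k2: "?k * (2 * pi) = sqrt (2 * pi * b)"
  proof -
    have "?k * sqrt ((2 * pi)\<^sup>2) = sqrt (2 * pi * b)"
      using b unfolding real_sqrt_mult[symmetric] by (simp add: power2_eq_square mult_ac)
    then show ?thesis unfolding real_sqrt_abs by simp
  qed
  have main: "?k * ?Q =
      coeff_sum_integral f x * (\<sigma> * (\<sigma> + 1) * sqrt (2 * pi * b)) / (x powr (\<sigma> + 1) * \<Phi>)"
  proof -
    have "x powr (- \<sigma> - 1) = x powr - (\<sigma> + 1)" by simp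
    also have "\<dots> = inverse (x powr (\<sigma> + 1))" by (rule powr_minus)
    finally have "?k * ?Q =
        ?k * (2 * pi) * (\<sigma> * (\<sigma> + 1) / \<Phi> * (coeff_sum_integral f x / x powr (\<sigma> + 1)))"
      by (simp only: divide_inverse mult_ac)
    then show ?thesis unfolding k2 by (simp add: mult_ac)
  qed
  have error: "?k * (LBINT t. U t) =
    \<epsilon> + 4 / sqrt (2 * pi) / (\<sigma> * sqrt b) + sqrt 2 * exp (- b * \<delta>\<^sup>2 / 4) +
    (\<sigma> + 1) / sqrt (2 * pi) * (\<sigma> * sqrt b / \<Phi> * J)"
  proof -
    have "?k * sqrt (2 * pi / (b / 2)) = sqrt 2"
      using b by (simp add: real_sqrt_mult[symmetric])
    moreover have "?k * (2 / \<sigma> * (2 / b)) = 4 / sqrt (2 * pi) / (\<sigma> * sqrt b)"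
    proof -
      have "sqrt b * sqrt b = b" using b by simp
      then have "sqrt b / b = 1 / sqrt b" using b by (simp add: field_simps)
      have "?k * (2 / \<sigma> * (2 / b)) = 4 / sqrt (2 * pi) / \<sigma> * (sqrt b / b)"
        by (simp add: real_sqrt_divide mult_ac)
      then show ?thesis unfolding \<open>sqrt b / b = 1 / sqrt b\<close> by simp
    qed
    moreover have "?k * (\<sigma> * (\<sigma> + 1) / \<Phi> * J) = (\<sigma> + 1) / sqrt (2 * pi) * (\<sigma> * sqrt b / \<Phi> * J)"
      by (simp add: real_sqrt_divide mult_ac)
    ultimately show ?thesis
      using k1 unfolding intU distrib_left mult.left_commute[of ?k]
      by (simp only: mult_1_right mult.commute[of _ "sqrt 2"])
  qed
  show ?thesis
    using bound unfolding expand unfolding k1 main error mult_1 .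
qed

section \<open>The uniform limit at the abscissa\<close>

lemma sqrt_exp: "sqrt (exp (x::real)) = exp (x / 2)"
  by (rule real_sqrt_unique) (simp_all add: exp_double[symmetric])

theorem theorem7:
  fixes f :: "nat \<Rightarrow> real" and \<alpha> \<beta> :: real and R :: "real \<Rightarrow> real \<Rightarrow> real"
  assumes "admissible f \<alpha>"
    and "\<beta> > \<alpha>"
    and "\<And>\<sigma>. \<sigma> \<in> {\<alpha><..<\<beta>} \<Longrightarrow> b_fun f \<sigma> > 0"
    and "\<And>x \<sigma>. x > 0 \<Longrightarrow> \<sigma> \<in> {\<alpha><..<\<beta>} \<Longrightarrow>
           coeff_sum_integral f x =
             x powr (\<sigma> + 1) * F_real f \<sigma> / (\<sigma> * (\<sigma> + 1) * sqrt (2 * pi * b_fun f \<sigma>)) *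
             (exp (- (a_fun f \<sigma> + ln x)\<^sup>2 / (2 * b_fun f \<sigma>)) + R x \<sigma>)"
  shows "uniform_limit {0<..} (\<lambda>\<sigma> x. R x \<sigma>) (\<lambda>x. 0) (at_right \<alpha>)"
proof -
  obtain \<beta>\<^sub>0 \<delta> where coeffs: "\<forall>n\<ge>1. f n \<ge> 0" "f 1 > 0" and absc: "abscissa f = ereal \<alpha>" and "\<alpha> \<ge> 0"
    and nz: "\<forall>s. Re s > \<alpha> \<longrightarrow> dirichlet_series f s \<noteq> 0"
    and \<beta>\<^sub>0: "\<beta>\<^sub>0 > \<alpha>" and \<delta>: "\<forall>\<sigma>\<in>{\<alpha><..<\<beta>\<^sub>0}. \<delta> \<sigma> \<in> {0<..<1}"
    and A5: "filterlim (\<lambda>\<sigma>. \<sigma>\<^sup>2 * b_fun f \<sigma>) at_top (at_right \<alpha>)"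
    and A6: "((\<lambda>\<sigma>. b_fun f \<sigma> * exp (- b_fun f \<sigma> * (\<delta> \<sigma>)\<^sup>2)) \<longlongrightarrow> 0) (at_right \<alpha>)"
    and A7: "\<forall>\<epsilon>>0. \<forall>\<^sub>F \<sigma> in at_right \<alpha>. \<forall>t. \<bar>t\<bar> \<le> \<delta> \<sigma> \<longrightarrow> norm (log_remainder f \<sigma> t) < \<epsilon>"
    and A8: "((\<lambda>\<sigma>. \<sigma> * sqrt (b_fun f \<sigma>) / F_real f \<sigma> *
              (LBINT t:{t. \<bar>t\<bar> \<ge> \<delta> \<sigma>}.
                 norm (dirichlet_series f (Complex \<sigma> t)) / (\<sigma>\<^sup>2 + t\<^sup>2))) \<longlongrightarrow> 0) (at_right \<alpha>)"
    using assms(1) unfolding admissible_def by blast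
  define J where "J = (\<lambda>\<sigma>. \<sigma> * sqrt (b_fun f \<sigma>) / F_real f \<sigma> *
              (LBINT t:{t. \<bar>t\<bar> \<ge> \<delta> \<sigma>}.
                 norm (dirichlet_series f (Complex \<sigma> t)) / (\<sigma>\<^sup>2 + t\<^sup>2)))"
  \<comment> \<open>\<open>B\<close> collects the errors other than that of the remainder. It
    depends on \<open>\<sigma>\<close> alone, whence the uniformity in \<open>x\<close>.\<close>
  define B where "B = (\<lambda>\<sigma>. 4 / sqrt (2 * pi) / (\<sigma> * sqrt (b_fun f \<sigma>)) +
    sqrt 2 * exp (- b_fun f \<sigma> * (\<delta> \<sigma>)\<^sup>2 / 4) + (\<sigma> + 1) / sqrt (2 * pi) * J \<sigma>)"
  have ev_\<sigma>: "\<forall>\<^sub>F \<sigma> in at_right \<alpha>. \<sigma> \<in> {\<alpha><..<c}" if "c > \<alpha>" for c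
    using eventually_at_right_real[OF that] .
  \<comment> \<open>Since \<open>\<alpha> \<ge> 0\<close>, \<open>\<sigma>\<close> is positive and
    the denominator is the square root of the expression in \<open>A5\<close>.\<close>
  have lim1: "((\<lambda>\<sigma>. 4 / sqrt (2 * pi) / (\<sigma> * sqrt (b_fun f \<sigma>))) \<longlongrightarrow> 0) (at_right \<alpha>)"
  proof (rule tendsto_divide_0[OF tendsto_const filterlim_at_top_imp_at_infinity])
    have "filterlim (\<lambda>\<sigma>. sqrt (\<sigma>\<^sup>2 * b_fun f \<sigma>)) at_top (at_right \<alpha>)"
      by (rule filterlim_compose[OF sqrt_at_top A5])
    moreover have "\<forall>\<^sub>F \<sigma> in at_right \<alpha>. sqrt (\<sigma>\<^sup>2 * b_fun f \<sigma>) = \<sigma> * sqrt (b_fun f \<sigma>)"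
      using ev_\<sigma>[OF assms(2)] by eventually_elim (use \<open>\<alpha> \<ge> 0\<close> in \<open>simp add: real_sqrt_mult\<close>)
    ultimately show "filterlim (\<lambda>\<sigma>. \<sigma> * sqrt (b_fun f \<sigma>)) at_top (at_right \<alpha>)"
      by (rule filterlim_cong[THEN iffD1, OF refl refl, rotated])
  qed
  have exp_lim: "((\<lambda>\<sigma>. exp (- b_fun f \<sigma> * (\<delta> \<sigma>)\<^sup>2)) \<longlongrightarrow> 0) (at_right \<alpha>)"
  proof (rule tendsto_sandwich[OF _ _ tendsto_const A6])
    \<comment> \<open>\<open>A6\<close> controls the exponential multiplied by \<open>b\<close>,
      which dominates the exponential alone once \<open>b \<ge> 1\<close>. The threshold is chosen
      to exceed \<open>\<sigma>\<^sup>2\<close> for \<open>\<sigma> < \<alpha> + 1\<close>, so that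
      cancelling \<open>\<sigma>\<^sup>2\<close> gives this.\<close>
    have "\<forall>\<^sub>F \<sigma> in at_right \<alpha>. (\<alpha> + 1)\<^sup>2 \<le> \<sigma>\<^sup>2 * b_fun f \<sigma>"
      using A5 by (simp add: filterlim_at_top)
    moreover have "\<forall>\<^sub>F \<sigma> in at_right \<alpha>. \<sigma> \<in> {\<alpha><..<\<alpha> + 1}" by (rule ev_\<sigma>) simp
    ultimately show "\<forall>\<^sub>F \<sigma> in at_right \<alpha>. exp (- b_fun f \<sigma> * (\<delta> \<sigma>)\<^sup>2) \<le>
        b_fun f \<sigma> * exp (- b_fun f \<sigma> * (\<delta> \<sigma>)\<^sup>2)"
    proof eventually_elim
      case (elim \<sigma>)
      have "\<sigma>\<^sup>2 \<le> (\<alpha> + 1)\<^sup>2" "\<sigma>\<^sup>2 > 0"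
        using elim \<open>\<alpha> \<ge> 0\<close> by (auto intro!: power_mono)
      then have "\<sigma>\<^sup>2 * 1 \<le> \<sigma>\<^sup>2 * b_fun f \<sigma>" using elim by linarith
      then have "1 \<le> b_fun f \<sigma>" using \<open>\<sigma>\<^sup>2 > 0\<close> by (simp only: mult_le_cancel_left_pos)
      then show ?case by simp
    qed
  qed simp
  \<comment> \<open>Two square roots divide the exponent by 4, as the tail term in \<open>B\<close>
    requires.\<close>
  have "((\<lambda>\<sigma>. sqrt (sqrt (exp (- b_fun f \<sigma> * (\<delta> \<sigma>)\<^sup>2)))) \<longlongrightarrow> sqrt (sqrt 0)) (at_right \<alpha>)"
    by (intro tendsto_real_sqrt exp_lim)
  then have lim2: "((\<lambda>\<sigma>. exp (- b_fun f \<sigma> * (\<delta> \<sigma>)\<^sup>2 / 4)) \<longlongrightarrow> 0) (at_right \<alpha>)"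
    by (simp add: sqrt_exp)
  have "(B \<longlongrightarrow> 0 + sqrt 2 * 0 + (\<alpha> + 1) / sqrt (2 * pi) * 0) (at_right \<alpha>)"
    unfolding B_def by (intro tendsto_intros lim1 lim2 A8[folded J_def]) auto
  then have B: "(B \<longlongrightarrow> 0) (at_right \<alpha>)" by simp
  show ?thesis
    unfolding uniform_limit_iff
  proof (intro allI impI)
    fix e :: real assume "e > 0"
    \<comment> \<open>Continuity of \<open>exp\<close> at 0 converts the small remainder of
      \<open>A7\<close> into the bound on \<open>exp (log_remainder f \<sigma> t) - 1\<close>. Half
      of \<open>e\<close> is spent here, half on \<open>B\<close>.\<close>
    have "isCont exp (0::complex)" by simp
    then obtain \<eta> where \<eta>: "\<eta> > 0" "\<And>z::complex. norm z < \<eta> \<Longrightarrow> norm (exp z - 1) < e / 2"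
      using \<open>e > 0\<close> unfolding continuous_at_eps_delta by (auto simp: dist_norm dest: spec[of _ "e / 2"])
    have "\<forall>\<^sub>F \<sigma> in at_right \<alpha>. \<forall>t. \<bar>t\<bar> \<le> \<delta> \<sigma> \<longrightarrow> norm (log_remainder f \<sigma> t) < \<eta>"
      using A7 \<eta>(1) by blast
    moreover have "\<forall>\<^sub>F \<sigma> in at_right \<alpha>. B \<sigma> < e / 2"
      using order_tendstoD(2)[OF B, of "e / 2"] \<open>e > 0\<close> by simp
    ultimately show "\<forall>\<^sub>F \<sigma> in at_right \<alpha>. \<forall>x\<in>{0<..}. dist (R x \<sigma>) 0 < e"
      using ev_\<sigma>[OF assms(2)] ev_\<sigma>[OF \<beta>\<^sub>0]
    proof eventually_elim
      case (elim \<sigma>)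
      show ?case
      proof
        fix x :: real assume "x \<in> {0<..}"
        then have x: "x > 0" by simp
        have \<sigma>: "\<sigma> > \<alpha>" "\<sigma> > 0" using elim \<open>\<alpha> \<ge> 0\<close> by auto
        have b: "b_fun f \<sigma> > 0" using assms(3) elim by blast
        \<comment> \<open>Positivity of the prefactor allows the defining equation to be solved for
          \<open>R x \<sigma>\<close>, which is then the quantity estimated in
          \<open>saddle_point_bound\<close>.\<close>
        have "F_real f \<sigma> > 0"
          using \<sigma> by (intro dirichlet_series_real_axis(1)[OF coeffs]) (simp add: conv_half_plane_eq[OF absc])
        then have R: "coeff_sum_integral f x * (\<sigma> * (\<sigma> + 1) * sqrt (2 * pi * b_fun f \<sigma>)) /
            (x powr (\<sigma> + 1) * F_real f \<sigma>) - exp (- (a_fun f \<sigma> + ln x)\<^sup>2 / (2 * b_fun f \<sigma>)) = R x \<sigma>"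
          unfolding assms(4)[OF x elim(3)] using x \<sigma> b by simp
        have "\<bar>R x \<sigma>\<bar> \<le> e / 2 + B \<sigma>"
          using saddle_point_bound[OF coeffs absc nz \<sigma> b x, of "\<delta> \<sigma>" "e / 2"] elim \<delta> \<eta>(2)
          unfolding R B_def J_def by (auto simp: less_imp_le add.assoc)
        then show "dist (R x \<sigma>) 0 < e" using elim by simp
      qed
    qed
  qed
qed

end
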